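(* Let $r > \frac{1}{\sqrt{3}}$ be real, and let $\theta = 2\sin^{-1}\left(\frac{r}{\sqrt{4r^2-1}}\right) = c\cdot\pi$. If $c$ is irrational, or if $c=\frac{p}{q}$ with $p,q\in\mathbb{N}$, $\gcd(p,q)=1$ and $p$ even, then $\chi_m(\mathbb{S}^2_r)\geq 5$.
   Context: $\mathbb{S}^2_r\subset\mathbb{R}^3$ is the 2-sphere of radius $r$ (centered at the origin), equipped with the chordal distance, i.e. the Euclidean distance of $\mathbb{R}^3$, and with the 2-dimensional spherical (surface) measure. Two points of $\mathbb{S}^2_r$ are adjacent if their chordal distance is exactly $1$. The measurable chromatic number $\chi_m(\mathbb{S}^2_r)$ is the minimum $k$ for which there is a function $\varphi:\mathbb{S}^2_r\to\{1,\dots,k\}$ such that $\varphi(u)\neq\varphi(v)$ whenever $u,v$ are adjacent and such that $\varphi^{-1}(i)$ is a measurable subset of $\mathbb{S}^2_r$ for every $i$. (The angle $\theta$ is the central angle, on the circle of points of $\mathbb{S}^2_r$ at distance $1$ from a given point, subtended by two points of that circle at distance $1$ from each other.) *)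

theory Defs
  imports "HOL-Analysis.Analysis" "HOL-Library.Extended_Nat"
begin

definition radial_projection :: "real \<Rightarrow> real^3 \<Rightarrow> real^3" where
  "radial_projection r x = (r / norm x) *\<^sub>R x"

(* Surface measure via the cone formula: for r > 0 the area of a Borel subset A of the sphere of
   radius r is 3/r times the volume of the open cone {t a | a in A, 0 < t < 1}, i.e. of the
   preimage of A under radial projection of the punctured ball.  Completed, so that every subset
   of a set of surface measure zero is measurable. *)
definition sphere_measure :: "real \<Rightarrow> (real^3) measure" where
  "sphere_measure r = completion
     (distr (scale_measure (ennreal (3 / r)) (restrict_space lborel (ball 0 r - {0})))
            (restrict_space borel (sphere 0 r))
            (radial_projection r))"

definition measurable_colouring :: "real \<Rightarrow> nat \<Rightarrow> (real^3 \<Rightarrow> nat) \<Rightarrow> bool" where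
  "measurable_colouring r k \<phi> \<longleftrightarrow>
     \<phi> \<in> sphere 0 r \<rightarrow> {1..k} \<and>
     (\<forall>u\<in>sphere 0 r. \<forall>v\<in>sphere 0 r. dist u v = 1 \<longrightarrow> \<phi> u \<noteq> \<phi> v) \<and>
     (\<forall>i\<in>{1..k}. {x \<in> sphere 0 r. \<phi> x = i} \<in> sets (sphere_measure r))"

definition measurable_chromatic_number :: "real \<Rightarrow> enat" where
  "measurable_chromatic_number r = (INF k\<in>{k. \<exists>\<phi>. measurable_colouring r k \<phi>}. enat k)"

lemma radial_projection_measurable:
  assumes "r > 0"
  shows "radial_projection r \<in> restrict_space lborel (ball 0 r - {0}) \<rightarrow>\<^sub>M restrict_space borel (sphere 0 r)"
proof (rule measurable_restrict_space2)
  show "radial_projection r \<in> space (restrict_space lborel (ball 0 r - {0})) \<rightarrow> sphere 0 r"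
    using assms by (auto simp: radial_projection_def space_restrict_space)
  show "radial_projection r \<in> borel_measurable (restrict_space lborel (ball 0 r - {0}))"
    unfolding radial_projection_def
    by (rule measurable_restrict_space1) measurable
qed

lemma space_sphere_measure [simp]: "space (sphere_measure r) = sphere 0 r"
  by (simp add: sphere_measure_def space_restrict_space)

lemma borel_in_sets_sphere_measure:
  assumes "B \<in> sets borel" "B \<subseteq> sphere 0 r"
  shows "B \<in> sets (sphere_measure r)"
  unfolding sphere_measure_def
  by (rule sets_completionI_sets) (use assms in \<open>auto simp: sets_restrict_space\<close>)

lemma emeasure_sphere_measure:
  assumes "r > 0" "B \<in> sets borel" "B \<subseteq> sphere 0 r"
  shows "emeasure (sphere_measure r) B =
     ennreal (3 / r) * emeasure lborel {x \<in> ball 0 r - {0}. radial_projection r x \<in> B}"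
proof -
  let ?M = "restrict_space lborel (ball 0 r - {0} :: (real^3) set)"
  have B: "B \<in> sets (restrict_space borel (sphere 0 r))"
    using assms by (auto simp: sets_restrict_space)
  have eq: "radial_projection r -` B \<inter> (ball 0 r - {0}) = {x \<in> ball 0 r - {0}. radial_projection r x \<in> B}"
    by auto
  have "emeasure (sphere_measure r) B = ennreal (3 / r) * emeasure ?M {x \<in> ball 0 r - {0}. radial_projection r x \<in> B}"
    unfolding sphere_measure_def using B radial_projection_measurable[OF assms(1)]
    by (subst emeasure_completion) (auto simp: emeasure_distr space_restrict_space space_scale_measure eq simp del: mem_ball_0)
  then show ?thesis
    by (subst (asm) emeasure_restrict_space) auto
qed

lemma emeasure_sphere_measure_space:
  assumes "r > 0"
  shows "emeasure (sphere_measure r) (sphere 0 r) = ennreal (4 * pi * r\<^sup>2)"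
proof -
  have "{x \<in> ball 0 r - {0}. radial_projection r x \<in> sphere 0 r} = ball 0 r - {0 :: real^3}"
    using assms by (auto simp: radial_projection_def)
  then have "emeasure (sphere_measure r) (sphere 0 r) =
      ennreal (3 / r) * emeasure lborel (ball 0 r - {0 :: real^3})"
    using emeasure_sphere_measure[OF assms, of "sphere 0 r"] by simp
  also have "emeasure lborel (ball 0 r - {0 :: real^3}) = emeasure lborel (ball 0 r :: (real^3) set)"
    by (rule emeasure_Diff_null_set) auto
  also have "\<dots> = ennreal (4 / 3 * pi * r ^ 3)"
    using assms by (simp add: emeasure_ball unit_ball_vol_3)
  also have "ennreal (3 / r) * ennreal (4 / 3 * pi * r ^ 3) = ennreal (4 * pi * r\<^sup>2)"
    using assms by (subst ennreal_mult[symmetric]) (auto simp: power2_eq_square power3_eq_cube)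
  finally show ?thesis .
qed

lemma ex_measurable_colouring: "\<exists>k \<phi>. measurable_colouring r k \<phi>"
proof -
  let ?S = "sphere 0 r :: (real^3) set"
  obtain C where C: "finite C" "?S \<subseteq> (\<Union>x\<in>C. ball x (1/2))"
    using compact_eq_totally_bounded[of ?S] by (metis compact_sphere half_gt_zero zero_less_one)
  obtain f n where f: "C = f ` {i::nat. i < n}"
    using finite_imp_nat_seg_image_inj_on[OF C(1)] by metis
  define P where "P x i \<longleftrightarrow> (\<exists>j. i = Suc j \<and> j < n \<and> x \<in> ball (f j) (1/2))" for x i
  define \<phi> where "\<phi> x = (LEAST i. P x i)" for x
  have ex: "\<exists>i. P x i" if "x \<in> ?S" for x
    using C that f unfolding P_def by blast
  have P: "P x (\<phi> x)" if "x \<in> ?S" for x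
    unfolding \<phi>_def using ex[OF that] by (rule LeastI_ex)
  have Pm: "P x i = (0 < i \<and> i \<le> n \<and> x \<in> ball (f (i - 1)) (1/2))" for x i
    unfolding P_def by (cases i) auto
  have "measurable_colouring r n \<phi>"
    unfolding measurable_colouring_def
  proof (intro conjI ballI impI)
    show "\<phi> \<in> ?S \<rightarrow> {1..n}"
      using P Pm by fastforce
    show "\<phi> u \<noteq> \<phi> v" if "u \<in> ?S" "v \<in> ?S" "dist u v = 1" for u v
    proof
      assume "\<phi> u = \<phi> v"
      with P[OF that(1)] P[OF that(2)] obtain c where "u \<in> ball c (1/2)" "v \<in> ball c (1/2)"
        by (auto simp: Pm)
      then show False
        using that(3) dist_triangle[of u v c] by (auto simp: dist_commute)
    qed
    fix i assume "i \<in> {1..n}"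
    have "{x \<in> ?S. \<phi> x = i} = {x \<in> ?S. P x i \<and> (\<forall>j<i. \<not> P x j)}"
      using P unfolding \<phi>_def by (auto dest: not_less_Least intro!: Least_equality leI)
    also have "\<dots> = ?S \<inter> (\<Inter>j\<in>{..<i}. {x. \<not> P x j}) \<inter> {x. P x i}"
      by auto
    also have "\<dots> \<in> sets borel"
    proof -
      have "{x. P x j} \<in> sets borel" for j
      proof -
        have "{x. P x j} = (if 0 < j \<and> j \<le> n then ball (f (j - 1)) (1/2) else {})"
          by (auto simp: Pm)
        then show ?thesis by simp
      qed
      moreover from this have "{x. \<not> P x j} \<in> sets borel" for j
        using borel_comp[of "{x. P x j}"] by (simp add: Collect_neg_eq)
      moreover have "?S \<inter> (\<Inter>j\<in>{..<i}. {x. \<not> P x j}) = ?S - (\<Union>j\<in>{..<i}. {x. P x j})"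
        by auto
      ultimately show ?thesis by auto
    qed
    finally show "{x \<in> ?S. \<phi> x = i} \<in> sets (sphere_measure r)"
      by (intro borel_in_sets_sphere_measure) auto
  qed
  then show ?thesis by blast
qed

lemma measurable_chromatic_number_attained:
  "\<exists>k \<phi>. measurable_chromatic_number r = enat k \<and> measurable_colouring r k \<phi>"
proof -
  let ?A = "enat ` {k. \<exists>\<phi>. measurable_colouring r k \<phi>}"
  have "?A \<noteq> {}"
    using ex_measurable_colouring by auto
  then have "Inf ?A \<in> ?A"
    by (metis Inf_enat_def LeastI_ex ex_in_conv)
  then show ?thesis
    by (auto simp: measurable_chromatic_number_def)
qed

end

theory Submission
  imports Defs "HOL-Probability.Probability_Measure" "HOL-Analysis.Kronecker_Approximation_Theorem"
begin

text \<open>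
  Suppose that the sphere is coloured with four measurable colours. For a point \<open>x\<close> and a colour
  \<open>i\<close>, consider the proportion of colour \<open>i\<close> on the circle of points at distance 1 from \<open>x\<close>. It is
  0 if \<open>x\<close> has colour \<open>i\<close>. As a function of \<open>x\<close> this proportion may be discontinuous, but the
  endpoint of a random walk of two unit steps has an absolutely continuous distribution. Therefore
  the restriction of the proportion to a unit circle varies continuously, in \<open>L\<^sup>1\<close>, with the circle
  (\<open>hit_move_L1_uniformly_continuous\<close>). This single analytic fact is used three times.

  First, there are points \<open>x\<close> for which two colours have arbitrarily small proportion
  (\<open>ex_two_rare_colours\<close>): otherwise the colour of a point would be a continuous function of these
  proportions, they would avoid an interval above 0, and connectedness would make a whole circle
  monochromatic, although it contains points at distance 1.

  Second, let \<open>i\<close> and \<open>j\<close> be rare on the circle about \<open>x\<close>. Two points of this circle that differ by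
  the central angle \<open>\<theta>\<close> are at distance 1, so the rotation by \<open>\<theta>\<close> mostly exchanges the other two
  colours \<open>k\<close> and \<open>l\<close>. The hypothesis on \<open>\<theta> / pi\<close> says that some odd multiple of \<open>\<theta>\<close> is
  arbitrarily close to a multiple of the full turn (\<open>odd_multiple_near_full_turn\<close>). Thus nearby
  points of the circle have both colours \<open>k\<close> and \<open>l\<close>, and by continuity neither \<open>k\<close> nor \<open>l\<close> is met
  by the unit circles about most points of the circle (\<open>other_colours_missed\<close>). In other words,
  walks of two steps from \<open>x\<close> nearly always end in the colours \<open>i\<close> and \<open>j\<close>.

  Third, the probabilities for two-step walks are continuous, so by compactness there is a point
  whose two-step walks almost surely avoid two colours exactly (\<open>ex_frame_two_step_missing\<close>). The
  second argument now applies to almost every neighbour, and by continuity to every neighbour, with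
  the two pairs of colours exchanged (\<open>missing_pair_swaps\<close>). So the avoided pair alternates along
  walks of unit steps. An equilateral triangle is a closed walk of length 3 (\<open>triangle_closes\<close>);
  going around it, both pairs would be avoided from the same point, which is impossible.
\<close>

section \<open>The uniform measure on the circle\<close>

definition angle_measure :: "real measure" where
  "angle_measure = uniform_measure lborel {0..<2 * pi}"

lemma sets_angle_measure [simp, measurable_cong]: "sets angle_measure = sets borel"
  and space_angle_measure [simp]: "space angle_measure = UNIV"
  by (simp_all add: angle_measure_def)

lemma prob_space_angle_measure: "prob_space angle_measure"
  unfolding angle_measure_def by (rule prob_space_uniform_measure) auto

interpretation angle: prob_space angle_measure
  by (rule prob_space_angle_measure)

lemma emeasure_angle_measure:
  "X \<in> sets borel \<Longrightarrow> emeasure angle_measure X = emeasure lborel ({0..<2*pi} \<inter> X) / ennreal (2*pi)"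
  unfolding angle_measure_def by simp

definition reduce_angle :: "real \<Rightarrow> real" where
  "reduce_angle x = x - 2 * pi * of_int \<lfloor>x / (2 * pi)\<rfloor>"

lemma reduce_angle_measurable [measurable]: "reduce_angle \<in> borel_measurable borel"
  unfolding reduce_angle_def by measurable

lemma reduce_angle_bounds: "0 \<le> reduce_angle x" "reduce_angle x < 2 * pi"
proof -
  have "of_int \<lfloor>x / (2 * pi)\<rfloor> \<le> x / (2*pi)" "x / (2*pi) < of_int \<lfloor>x / (2 * pi)\<rfloor> + 1"
    by linarith+
  then have "of_int \<lfloor>x / (2 * pi)\<rfloor> * (2*pi) \<le> x" "x < (of_int \<lfloor>x / (2 * pi)\<rfloor> + 1) * (2*pi)"
    by (simp_all only: pos_le_divide_eq[of "2*pi"] pos_divide_less_eq[of "2*pi"] pi_gt_zero mult_pos_pos zero_less_numeral)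
  then show "0 \<le> reduce_angle x" "reduce_angle x < 2 * pi"
    by (simp_all add: reduce_angle_def algebra_simps)
qed

lemma reduce_angle_shift: "reduce_angle (x + 2 * pi * of_int k) = reduce_angle x"
proof -
  have "(x + 2 * pi * of_int k) / (2*pi) = x / (2*pi) + of_int k" by (simp add: field_simps)
  then show ?thesis by (simp add: reduce_angle_def algebra_simps)
qed

lemma reduce_angle_eq:
  assumes a: "0 \<le> x + 2 * pi * of_int k" "x + 2 * pi * of_int k < 2 * pi"
  shows "reduce_angle x = x + 2 * pi * of_int k"
proof -
  have "reduce_angle x = reduce_angle (x + 2 * pi * of_int k)" by (simp add: reduce_angle_shift)
  moreover have "\<lfloor>(x + 2 * pi * of_int k) / (2*pi)\<rfloor> = 0" using a by (simp add: floor_eq_iff)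
  ultimately show ?thesis by (simp add: reduce_angle_def)
qed

lemma emeasure_lborel_translate:
  assumes "X \<in> sets borel"
  shows "emeasure lborel {x::real. x + s \<in> X} = emeasure lborel X"
proof -
  have "emeasure lborel X = emeasure (distr lborel borel ((+) s)) X"
    by (simp add: lborel_distr_plus)
  also have "\<dots> = emeasure lborel {x. x + s \<in> X}"
    using assms by (subst emeasure_distr) (auto simp: vimage_def add.commute)
  finally show ?thesis by simp
qed

text \<open>
  Rotation invariance of the uniform measure on the circle. Cutting the circle at the angle that
  the rotation sends to \<open>0\<close> splits the preimage of a set into two pieces, each of which is a
  translate of a piece of the set.
\<close>

lemma distr_angle_measure_rotate:
  "distr angle_measure borel (\<lambda>x. reduce_angle (x + s)) = angle_measure"
proof (rule measure_eqI)
  fix X assume "X \<in> sets (distr angle_measure borel (\<lambda>x. reduce_angle (x + s)))"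
  then have X[measurable]: "X \<in> sets borel" by simp
  define u where "u = reduce_angle s"
  have u: "0 \<le> u" "u < 2*pi" unfolding u_def by (rule reduce_angle_bounds)+
  have us: "reduce_angle (x + s) = reduce_angle (x + u)" for x
    using reduce_angle_shift[of "x + u" "\<lfloor>s / (2 * pi)\<rfloor>"] by (simp add: u_def reduce_angle_def)
  let ?P = "{0..<2*pi} \<inter> {x. reduce_angle (x + u) \<in> X}"
  have split: "?P = {x. x + u \<in> X \<inter> {u..<2*pi}} \<union> {x. x + (u - 2*pi) \<in> X \<inter> {0..<u}}" (is "_ = ?A \<union> ?B")
  proof (intro set_eqI)
    fix x
    show "x \<in> ?P \<longleftrightarrow> x \<in> ?A \<union> ?B"
    proof (cases "0 \<le> x \<and> x < 2*pi")
      case True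
      then consider "x + u < 2*pi" | "x + u \<ge> 2*pi" by linarith
      then show ?thesis
      proof cases
        case 1
        then show ?thesis using True u reduce_angle_eq[of "x+u" 0] by auto
      next
        case 2
        then have "reduce_angle (x + u) = x + (u - 2 * pi)"
          using True u reduce_angle_eq[of "x+u" "-1"] by simp
        then show ?thesis using 2 True u by auto
      qed
    qed (use u in auto)
  qed
  have m: "?A \<in> sets borel" "?B \<in> sets borel" by measurable
  have "emeasure lborel ?P = emeasure lborel ?A + emeasure lborel ?B"
    unfolding split by (rule plus_emeasure[symmetric]) (use m u in \<open>auto\<close>)
  also have "\<dots> = emeasure lborel (X \<inter> {u..<2*pi}) + emeasure lborel (X \<inter> {0..<u})"
    by (subst (1 2) emeasure_lborel_translate) auto
  also have "\<dots> = emeasure lborel ((X \<inter> {u..<2*pi}) \<union> (X \<inter> {0..<u}))"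
    by (rule plus_emeasure) auto
  also have "(X \<inter> {u..<2*pi}) \<union> (X \<inter> {0..<u}) = {0..<2*pi} \<inter> X" using u by auto
  finally have "emeasure lborel ?P = emeasure lborel ({0..<2*pi} \<inter> X)" .
  then show "emeasure (distr angle_measure borel (\<lambda>x. reduce_angle (x + s))) X = emeasure angle_measure X"
    by (subst emeasure_distr) (auto simp: emeasure_angle_measure us vimage_def)
qed auto

lemma periodic_reduce_angle:
  assumes "\<And>x. f (x + 2 * pi) = f x"
  shows "f (reduce_angle x) = f x"
proof -
  interpret periodic_fun_simple f "2*pi" by standard (rule assms)
  show ?thesis unfolding reduce_angle_def using minus_of_int[of x "\<lfloor>x / (2 * pi)\<rfloor>"] by (simp add: mult.commute)
qed

lemma measure_angle_shift:
  assumes [measurable]: "Measurable.pred borel P" and "\<And>x. P (x + 2 * pi) = P x"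
  shows "measure angle_measure {x. P (x + s)} = measure angle_measure {x. P x}"
proof -
  have "measure angle_measure {x. P x} = measure (distr angle_measure borel (\<lambda>x. reduce_angle (x + s))) {x. P x}"
    by (simp add: distr_angle_measure_rotate)
  also have "\<dots> = measure angle_measure {x. P (reduce_angle (x + s))}"
    by (subst measure_distr) (auto simp: vimage_def)
  finally show ?thesis using periodic_reduce_angle[of P, OF assms(2)] by simp
qed

lemma AE_angle_shift:
  assumes [measurable]: "Measurable.pred borel P" and "\<And>x. P (x + 2 * pi) = P x"
    and "AE x in angle_measure. P x"
  shows "AE x in angle_measure. P (x + s)"
proof -
  have "AE x in distr angle_measure borel (\<lambda>x. reduce_angle (x + s)). P x"
    using assms(3) by (subst distr_angle_measure_rotate)
  then have "AE x in angle_measure. P (reduce_angle (x + s))"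
    by (subst (asm) AE_distr_iff) auto
  then show ?thesis using periodic_reduce_angle[of P, OF assms(2)] by simp
qed

lemma integral_angle_shift:
  fixes f :: "real \<Rightarrow> real"
  assumes [measurable]: "f \<in> borel_measurable borel" and "\<And>x. f (x + 2 * pi) = f x"
  shows "(\<integral>x. f (x + s) \<partial>angle_measure) = (\<integral>x. f x \<partial>angle_measure)"
proof -
  have "(\<integral>x. f x \<partial>angle_measure) = (\<integral>x. f x \<partial>distr angle_measure borel (\<lambda>x. reduce_angle (x + s)))"
    by (simp add: distr_angle_measure_rotate)
  also have "\<dots> = (\<integral>x. f (reduce_angle (x + s)) \<partial>angle_measure)"
    by (subst integral_distr) auto
  finally show ?thesis using periodic_reduce_angle[of f, OF assms(2)] by simp
qed

lemma AE_angle_interval_witness: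
  assumes "AE x in angle_measure. P x" "0 \<le> a" "a < b" "b \<le> 2 * pi"
  obtains x where "a < x" "x < b" "P x"
proof -
  have "\<exists>x. a < x \<and> x < b \<and> P x"
  proof (rule ccontr)
    assume "\<not> ?thesis"
    then have "AE x in angle_measure. x \<notin> {a<..<b}"
      using assms(1) by (auto elim!: eventually_mono)
    then have "emeasure angle_measure {a<..<b} = 0"
      by (subst (asm) AE_iff_measurable[of "{a<..<b}"]) auto
    moreover have "{0..<2*pi} \<inter> {a<..<b} = {a<..<b}" using assms by auto
    ultimately have "ennreal (b - a) / ennreal (2*pi) = 0"
      using assms by (simp add: emeasure_angle_measure del: ennreal_divide_eq_0_iff)
    then show False using assms by (simp add: divide_ennreal ennreal_divide_eq_0_iff)
  qed
  then show ?thesis using that by blast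
qed

text \<open>
  Constraints that a continuous periodic function satisfies at almost every angle pass to every
  angle; rotating the given angle to \<open>pi\<close> avoids a case distinction at the end points of the
  fundamental interval.
\<close>

lemma AE_angle_closed_imp_all:
  fixes F :: "real \<Rightarrow> real"
  assumes cont: "continuous_on UNIV F" and per: "\<And>x. F (x + 2 * pi) = F x"
    and ae: "AE x in angle_measure. F x \<in> C" and C: "closed C"
  shows "F x \<in> C"
proof -
  have [measurable]: "F \<in> borel_measurable borel" "C \<in> sets borel"
    using cont C by (auto intro: borel_measurable_continuous_onI)
  have ae_shift: "AE y in angle_measure. F (y + (x - pi)) \<in> C"
    by (rule AE_angle_shift[where P = "\<lambda>x. F x \<in> C"]) (use per ae in auto)
  have w: "\<exists>y. pi < y \<and> y < pi + min \<delta> pi \<and> F (y + (x - pi)) \<in> C" if "\<delta> > 0" for \<delta>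
  proof (rule AE_angle_interval_witness)
    show "AE y in angle_measure. F (y + (x - pi)) \<in> C" by (rule ae_shift)
    show "pi < pi + min \<delta> pi" "pi + min \<delta> pi \<le> 2 * pi" "0 \<le> pi" using that by auto
  qed blast
  have "x \<in> closure {y. F y \<in> C}"
    unfolding closure_approachable
  proof (intro allI impI)
    fix e :: real assume "e > 0"
    with w obtain y where y: "pi < y" "y < pi + min e pi" "F (y + (x - pi)) \<in> C" by blast
    then show "\<exists>y\<in>{y. F y \<in> C}. dist y x < e"
      by (intro bexI[of _ "y + (x - pi)"]) (auto simp: dist_real_def)
  qed
  moreover have "closed {y. F y \<in> C}"
    using continuous_closed_vimage[OF C, of F] cont by (simp add: vimage_def continuous_on_eq_continuous_at)
  ultimately show ?thesis by (simp add: closure_closed)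
qed

text \<open>
  The only place where the arithmetic of the angle enters. For a fraction with even numerator the
  denominator \<open>q\<close> is odd and \<open>q\<close> steps return exactly to the starting point. For irrational \<open>c\<close>
  the odd multiples \<open>2 * k + 1\<close> are reached through Kronecker's theorem, by letting \<open>k * c\<close>
  approximate \<open>- c / 2\<close> modulo 1.
\<close>

lemma odd_multiple_near_full_turn:
  assumes c: "c \<notin> \<rat> \<or> (\<exists>p q :: nat. q > 0 \<and> c = real p / real q \<and> gcd p q = 1 \<and> even p)"
    and e: "e > 0"
  obtains m :: nat and l :: int where "odd m" "\<bar>real m * (c * pi) - 2 * pi * of_int l\<bar> < e"
proof -
  from c consider "c \<notin> \<rat>" | p q :: nat where "q > 0" "c = real p / real q" "gcd p q = 1" "even p" by auto
  then show ?thesis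
  proof cases
    case 1
    define h where "h = frac (- c / 2)"
    have h: "0 \<le> h" "h \<le> 1" using frac_lt_1[of "-c/2"] by (auto simp: h_def)
    obtain k where k: "k > 0" "\<bar>frac (real k * c) - h\<bar> < e / (2*pi)"
      using Kronecker_approx_1_explicit[OF 1 h, of "e / (2*pi)"] e by auto
    define l where "l = \<lfloor>real k * c\<rfloor> - \<lfloor>- c / 2\<rfloor>"
    have "frac (real k * c) - h = real k * c + c / 2 - of_int l"
      by (simp add: frac_def h_def l_def)
    then have "\<bar>real k * c + c / 2 - of_int l\<bar> * (2*pi) < e"
      using k(2) by (simp only: pos_less_divide_eq[of "2*pi"] pi_gt_zero mult_pos_pos zero_less_numeral)
    then have "\<bar>(real k * c + c / 2 - of_int l) * (2*pi)\<bar> < e"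
      by (simp add: abs_mult)
    moreover have "(real k * c + c / 2 - of_int l) * (2*pi) = real (2*k+1) * (c * pi) - 2 * pi * of_int l"
      by (simp add: algebra_simps)
    ultimately show ?thesis using that[of "2*k+1" l] by simp
  next
    case 2
    then have "odd q" using gcd_greatest[of 2 p q] by auto
    moreover obtain p' where "p = 2 * p'" using 2 by auto
    moreover have "real q * (c * pi) = real p * pi" using 2 by simp
    ultimately have "odd q" "real q * (c * pi) - 2 * pi * of_int (int p') = 0" by simp_all
    then show ?thesis using e by (intro that[of q "int p'"]) (simp_all only: abs_zero not_False_eq_True)
  qed
qed

section \<open>Rotations and unit steps on the sphere\<close>

definition rot :: "real \<Rightarrow> real^3^3" where
  "rot \<phi> = vector [vector [cos \<phi>, - sin \<phi>, 0], vector [sin \<phi>, cos \<phi>, 0], vector [0, 0, 1]]"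

lemmas matrix_3_simps = vec_eq_iff forall_3 matrix_matrix_mult_def matrix_vector_mult_def
  sum_3 transpose_def mat_def

lemma rot_add: "rot a ** rot b = rot (a + b)"
  by (simp add: matrix_3_simps rot_def cos_add sin_add)

lemma rot_periodic: "rot (a + 2 * pi) = rot a"
  by (simp add: rot_def)

lemma rot_periodic_int: "rot (a + 2 * pi * of_int l) = rot a"
proof -
  interpret periodic_fun_simple rot "2*pi" by standard (rule rot_periodic)
  show ?thesis using plus_of_int[of a l] by (simp add: mult.commute)
qed

lemma orthogonal_rot: "orthogonal_matrix (rot a)"
  by (simp add: orthogonal_matrix matrix_3_simps rot_def flip: power2_eq_square)

lemma continuous_on_rot: "continuous_on UNIV rot"
proof -
  have "continuous_on UNIV (\<lambda>\<phi>. rot \<phi> $ i $ j)" for i j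
    using exhaust_3[of i] exhaust_3[of j] by (auto simp: rot_def) (intro continuous_intros)+
  then have "continuous_on UNIV (\<lambda>\<phi>. \<chi> i j. rot \<phi> $ i $ j)"
    by (intro continuous_on_vec_lambda) 
  then show ?thesis by simp
qed

locale unit_distance_sphere =
  fixes r \<theta> :: real
  assumes r_gt: "r > 1 / sqrt 3"
    and theta: "\<theta> = 2 * arcsin (r / sqrt (4 * r\<^sup>2 - 1))"
begin

text \<open>
  The cosine and the sine of the angle at the centre of the sphere between two points at
  distance 1.
\<close>

definition "cos_step = 1 - 1 / (2 * r\<^sup>2)"
definition "sin_step = sqrt (4 * r\<^sup>2 - 1) / (2 * r\<^sup>2)"

text \<open>
  An orthogonal matrix \<open>g\<close> is used as a frame sitting at the point \<open>g *v pole\<close>: the matrix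
  \<open>g ** rot \<phi> ** tilt\<close> is the frame obtained by turning through \<open>\<phi>\<close> and then walking straight
  ahead for distance 1.
\<close>

definition tilt :: "real^3^3" where
  "tilt = vector [vector [cos_step, 0, sin_step], vector [0, 1, 0], vector [- sin_step, 0, cos_step]]"

definition pole :: "real^3" where "pole = vector [0, 0, r]"

definition neighbour :: "real^3" where "neighbour = tilt *v pole"

lemma r_pos: "r > 0"
  using r_gt by (smt (verit) divide_pos_pos real_sqrt_gt_zero)

lemma r_sq: "3 * r\<^sup>2 > 1"
proof -
  have "(1 / sqrt 3)\<^sup>2 < r\<^sup>2" using r_gt by (intro power_strict_mono) auto
  then show ?thesis by (simp add: power_divide)
qed

lemma sin_step_pos: "sin_step > 0"
  using r_sq r_pos by (simp add: sin_step_def)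

lemma cos_sin_step: "cos_step\<^sup>2 + sin_step\<^sup>2 = 1"
proof -
  have "sin_step\<^sup>2 = (4 * r\<^sup>2 - 1) / (4 * (r\<^sup>2)\<^sup>2)"
    using r_sq by (simp add: sin_step_def power_divide power_mult_distrib)
  then show ?thesis using r_pos
    by (simp add: cos_step_def power2_diff power_divide field_simps)
qed

text \<open>
  This relation says that \<open>\<theta>\<close> is the angle of the equilateral spherical triangle of side 1, by
  the spherical law of cosines.
\<close>

lemma cos_theta: "cos \<theta> * (1 + cos_step) = cos_step"
proof -
  have p: "4 * r\<^sup>2 - 1 > 0" using r_sq by simp
  have "r / sqrt (4 * r\<^sup>2 - 1) \<le> 1" "0 \<le> r / sqrt (4 * r\<^sup>2 - 1)"
    using p r_pos r_sq by (auto intro!: real_le_rsqrt)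
  then have "sin (\<theta> / 2) = r / sqrt (4 * r\<^sup>2 - 1)" by (simp add: theta)
  then have "(sin (\<theta> / 2))\<^sup>2 = r\<^sup>2 / (4 * r\<^sup>2 - 1)" using p by (simp add: power_divide)
  then have "cos \<theta> = 1 - 2 * r\<^sup>2 / (4 * r\<^sup>2 - 1)"
    using cos_double_sin[of "\<theta> / 2"] by simp
  then show ?thesis using p r_pos by (simp add: cos_step_def field_simps)
qed

lemma dist_step: "2 * r\<^sup>2 * (1 - cos_step) = 1"
  using r_pos by (simp add: cos_step_def)

lemma orthogonal_tilt: "orthogonal_matrix tilt"
  using cos_sin_step by (simp add: orthogonal_matrix matrix_3_simps tilt_def power2_eq_square mult.commute add.commute)

lemma neighbour_eq: "neighbour = vector [r * sin_step, 0, r * cos_step]"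
  by (simp add: neighbour_def matrix_3_simps tilt_def pole_def mult.commute)

lemma dist_pole_rot_neighbour: "dist pole (rot a *v neighbour) = 1"
proof -
  have "(dist pole (rot a *v neighbour))\<^sup>2 = (cos a * (r * sin_step))\<^sup>2 + (sin a * (r * sin_step))\<^sup>2 + (r - r * cos_step)\<^sup>2"
    unfolding dist_norm power2_norm_eq_inner
    by (simp add: inner_vec_def neighbour_eq pole_def rot_def matrix_3_simps power2_eq_square)
  also have "\<dots> = 2 * r\<^sup>2 * (1 - cos_step)"
    using cos_sin_step sin_cos_squared_add[of a] by algebra
  finally show ?thesis
    using dist_step zero_le_dist[of pole "rot a *v neighbour"] by (auto simp: power2_eq_1_iff)
qed

lemma dist_rot_neighbour_theta: "dist (rot a *v neighbour) (rot (a + \<theta>) *v neighbour) = 1"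
proof -
  have "(dist (rot a *v neighbour) (rot (a + \<theta>) *v neighbour))\<^sup>2
      = (cos a * (r * sin_step) - cos (a + \<theta>) * (r * sin_step))\<^sup>2 + (sin a * (r * sin_step) - sin (a + \<theta>) * (r * sin_step))\<^sup>2"
    unfolding dist_norm power2_norm_eq_inner
    by (simp add: inner_vec_def neighbour_eq rot_def matrix_3_simps power2_eq_square)
  also have "\<dots> = r\<^sup>2 * sin_step\<^sup>2 * ((cos a - cos (a + \<theta>))\<^sup>2 + (sin a - sin (a + \<theta>))\<^sup>2)"
    by algebra
  also have "(cos a - cos (a + \<theta>))\<^sup>2 + (sin a - sin (a + \<theta>))\<^sup>2 = 2 - 2 * cos \<theta>"
  proof -
    have "cos \<theta> = cos (a + \<theta>) * cos a + sin (a + \<theta>) * sin a" using cos_diff[of "a + \<theta>" a] by simp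
    then show ?thesis using sin_cos_squared_add[of a] sin_cos_squared_add[of "a + \<theta>"] by algebra
  qed
  also have "r\<^sup>2 * sin_step\<^sup>2 * (2 - 2 * cos \<theta>) = 1"
  proof -
    have "sin_step\<^sup>2 = (1 - cos_step) * (1 + cos_step)" using cos_sin_step by algebra
    then show ?thesis using dist_step cos_theta by algebra
  qed
  finally show ?thesis
    using zero_le_dist[of "rot a *v neighbour" "rot (a + \<theta>) *v neighbour"]
    by (simp only: power2_eq_1_iff) linarith
qed

text \<open>
  Walking around an equilateral triangle of side 1, turning by the exterior angle \<open>pi - \<theta>\<close> at
  each corner, returns the frame to its initial position. This closed walk of odd length is what
  makes an alternation along walks contradictory. The identity is the same closed walk with its
  third side moved to the other side of the equation.
\<close>

lemma triangle_closes: "tilt ** rot (pi - \<theta>) ** tilt = rot \<theta> ** tilt ** rot \<theta>"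
proof -
  define c s C S where [simp]: "c = cos_step" "s = sin_step" "C = cos \<theta>" "S = sin \<theta>"
  have 1: "s\<^sup>2 = 1 - c\<^sup>2" "S\<^sup>2 = 1 - C\<^sup>2" and 2: "C * (1 + c) = c"
    using cos_sin_step cos_theta by (auto simp: sin_squared_eq)
  have "C * S * (1 + c) = S * (C * (1 + c))" "s * c * (1 - C) = s * (c - c * C)" by algebra+
  moreover have "c - c * C = C" using 2 unfolding distrib_left mult.commute[of c C] by linarith
  ultimately have 3: "C * S * (1 + c) = c * S" and 4: "s * c * (1 - C) = C * s"
    unfolding 2 by (simp_all only: mult.commute)
  have "tilt ** rot (pi - \<theta>) ** tilt
      = vector [vector [- c\<^sup>2 * C - s\<^sup>2, - (c * S), s * c * (1 - C)],
                vector [S * c, - C, S * s], vector [s * c * (C - 1), s * S, s\<^sup>2 * C + c\<^sup>2]]"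
    by (simp add: matrix_3_simps tilt_def rot_def power2_eq_square algebra_simps)
  also have "- c\<^sup>2 * C - s\<^sup>2 = C\<^sup>2 * c - S\<^sup>2" using 1 2 by algebra
  also have "c * S = C * S * (1 + c)" by (rule 3[symmetric])
  also have "s * c * (1 - C) = C * s" by (rule 4)
  also have "S * c = C * S * (1 + c)" unfolding 3 by (rule mult.commute)
  also have "- C = C\<^sup>2 - S\<^sup>2 * c" using 1 2 by algebra
  also have "s * c * (C - 1) = - (C * s)" using 4 by algebra
  also have "s\<^sup>2 * C + c\<^sup>2 = c" using 1 2 by algebra
  also have "vector [vector [C\<^sup>2 * c - S\<^sup>2, - (C * S * (1 + c)), C * s],
                vector [C * S * (1 + c), C\<^sup>2 - S\<^sup>2 * c, S * s], vector [- (C * s), s * S, c]]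
      = rot \<theta> ** tilt ** rot \<theta>"
    by (simp add: matrix_3_simps tilt_def rot_def power2_eq_square algebra_simps)
  finally show ?thesis .
qed

definition two_step :: "real \<Rightarrow> real \<Rightarrow> real^3" where
  "two_step \<phi> \<psi> = rot \<phi> *v (tilt *v (rot \<psi> *v neighbour))"

definition scaled_two_step :: "real^3 \<Rightarrow> real^3" where
  "scaled_two_step p = (p $ 1) *\<^sub>R two_step (p $ 2) (p $ 3)"

text \<open>
  Cartesian coordinates of \<open>tilt *v (rot \<psi> *v neighbour)\<close>, the two-step point for \<open>\<phi> = 0\<close>.
\<close>

definition "vx \<psi> = r * sin_step * cos_step * (cos \<psi> + 1)"
definition "vy \<psi> = r * sin_step * sin \<psi>"
definition "vz \<psi> = r * (cos_step\<^sup>2 - sin_step\<^sup>2 * cos \<psi>)"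

lemma two_step_eq: "two_step \<phi> \<psi> =
    vector [cos \<phi> * vx \<psi> - sin \<phi> * vy \<psi>, sin \<phi> * vx \<psi> + cos \<phi> * vy \<psi>, vz \<psi>]"
  by (simp add: two_step_def matrix_3_simps tilt_def rot_def neighbour_eq vx_def vy_def vz_def power2_eq_square algebra_simps)

lemma norm_neighbour: "norm neighbour = r"
proof -
  have "(norm neighbour)\<^sup>2 = r\<^sup>2 * (sin_step\<^sup>2 + cos_step\<^sup>2)"
    unfolding power2_norm_eq_inner by (simp add: inner_vec_def sum_3 neighbour_eq power2_eq_square algebra_simps)
  then show ?thesis using cos_sin_step r_pos by (simp add: add.commute)
qed

lemma norm_orthogonal_matrix: "orthogonal_matrix (g::real^3^3) \<Longrightarrow> norm (g *v x) = norm x"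
  by (metis orthogonal_transformation_matrix orthogonal_transformation_norm matrix_of_matrix_vector_mul matrix_vector_mul_linear)

lemma norm_two_step: "norm (two_step \<phi> \<psi>) = r"
  unfolding two_step_def by (simp add: norm_orthogonal_matrix orthogonal_rot orthogonal_tilt norm_neighbour)

text \<open>
  Away from the origin, the determinant of the derivative vanishes only where \<open>sin \<psi> = 0\<close>, that is,
  where the walk goes straight on or straight back. Hence a random two-step walk has a distribution that is absolutely
  continuous with respect to area. A single step has no such property: it stays on a circle.
\<close>

definition jacobian :: "real^3 \<Rightarrow> real^3^3" where
  "jacobian p = (let t = p $ 1; \<phi> = p $ 2; \<psi> = p $ 3; a = sin_step * r in
     vector [
      vector [cos \<phi> * vx \<psi> - sin \<phi> * vy \<psi>, t * (- sin \<phi> * vx \<psi> - cos \<phi> * vy \<psi>),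
        t * (- cos \<phi> * (a * cos_step * sin \<psi>) - sin \<phi> * (a * cos \<psi>))],
      vector [sin \<phi> * vx \<psi> + cos \<phi> * vy \<psi>, t * (cos \<phi> * vx \<psi> - sin \<phi> * vy \<psi>),
        t * (- sin \<phi> * (a * cos_step * sin \<psi>) + cos \<phi> * (a * cos \<psi>))],
      vector [vz \<psi>, 0, t * (a * sin_step * sin \<psi>)]])"

lemma has_derivative_scaled_two_step:
  "(scaled_two_step has_derivative (\<lambda>h. jacobian p *v h)) (at p within S)"
proof -
  have nth: "((\<lambda>p::real^3. p $ i) has_derivative (\<lambda>h. h $ i)) (at p within S)" for i
    by (rule bounded_linear.has_derivative[OF bounded_linear_vec_nth has_derivative_ident])
  have "((\<lambda>p. scaled_two_step p $ i) has_derivative (\<lambda>h. (jacobian p *v h) $ i)) (at p within S)" for i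
  proof -
    consider "i = 1" | "i = 2" | "i = 3" using exhaust_3 by blast
    then show ?thesis
    proof cases
      case 1
      show ?thesis unfolding 1 scaled_two_step_def two_step_eq vx_def vy_def vz_def
        apply simp
        apply (rule derivative_eq_intros nth refl)+
        apply (rule ext)
        apply (simp add: jacobian_def Let_def matrix_vector_mult_def sum_3 vx_def vy_def vz_def algebra_simps)
        done
    next
      case 2
      show ?thesis unfolding 2 scaled_two_step_def two_step_eq vx_def vy_def vz_def
        apply simp
        apply (rule derivative_eq_intros nth refl)+
        apply (rule ext)
        apply (simp add: jacobian_def Let_def matrix_vector_mult_def sum_3 vx_def vy_def vz_def algebra_simps)
        done
    next
      case 3
      show ?thesis unfolding 3 scaled_two_step_def two_step_eq vx_def vy_def vz_def
        apply simp
        apply (rule derivative_eq_intros nth refl)+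
        apply (rule ext)
        apply (simp add: jacobian_def Let_def matrix_vector_mult_def sum_3 vx_def vy_def vz_def power2_eq_square algebra_simps)
        done
    qed
  qed
  then show ?thesis
    by (subst has_derivative_componentwise_within) (auto simp: Basis_vec_def inner_axis)
qed

lemma det_jacobian: "det (jacobian p) = (p $ 1)\<^sup>2 * (r\<^sup>2 * (r * sin_step\<^sup>2 * sin (p $ 3)))"
proof -
  let ?f = "p $ 2" and ?s = "p $ 3"
  have "(sin ?f)\<^sup>2 + (cos ?f)\<^sup>2 = 1" "(sin ?s)\<^sup>2 + (cos ?s)\<^sup>2 = 1" by auto
  then show ?thesis using cos_sin_step
    unfolding det_3 jacobian_def Let_def vector_3 vx_def vy_def vz_def by algebra
qed

lemma cos_inj_on_half_turn:
  assumes "x \<in> {k * pi<..<(k + 1) * pi}" "y \<in> {k * pi<..<(k + 1) * pi}" "k \<in> {0, 1}" "cos x = cos y"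
  shows "x = (y::real)"
proof (cases "k = 0")
  case True
  then show ?thesis using assms cos_inj_pi[of x y] by auto
next
  case False
  then have "2 * pi - x \<in> {0<..<pi}" "2 * pi - y \<in> {0<..<pi}" using assms by auto
  moreover have "cos (2 * pi - x) = cos (2 * pi - y)" using assms(4) by (simp add: cos_diff)
  ultimately show ?thesis using cos_inj_pi[of "2*pi - x" "2*pi - y"] by auto
qed

text \<open>
  On each of the two boxes \<open>k = 0\<close> and \<open>k = 1\<close> the height of the two-step point determines \<open>\<psi>\<close>,
  so the parametrization is injective there; together the boxes exhaust the parameters up to a
  null set.
\<close>

definition parameter_box :: "real \<Rightarrow> (real^3) set" where
  "parameter_box k = {p. p $ 1 \<in> {0<..<1} \<and> p $ 2 \<in> {0<..<2*pi} \<and> p $ 3 \<in> {k * pi<..<(k + 1) * pi}}"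

lemma parameter_box_eq: "parameter_box k = box (vector [0, 0, k * pi]) (vector [1, 2*pi, (k + 1) * pi])"
  by (auto simp: parameter_box_def mem_box_cart forall_3)

lemma sin_nonzero_half_turn: "x \<in> {k * pi<..<(k + 1) * pi} \<Longrightarrow> k \<in> {0, 1} \<Longrightarrow> sin x \<noteq> 0"
  using sin_gt_zero[of x] sin_lt_zero[of x] by force

lemma inj_on_scaled_two_step:
  assumes k: "k \<in> {0, 1}"
  shows "inj_on scaled_two_step (parameter_box k)"
proof (rule inj_onI)
  fix p q assume p: "p \<in> parameter_box k" and q: "q \<in> parameter_box k" and eq: "scaled_two_step p = scaled_two_step q"
  have "norm (scaled_two_step p) = norm (scaled_two_step q)" using eq by simp
  then have 1: "p $ 1 = q $ 1" using p q r_pos by (simp add: scaled_two_step_def norm_two_step parameter_box_def)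
  then have ts: "two_step (p $ 2) (p $ 3) = two_step (q $ 2) (q $ 3)"
    using eq p by (auto simp: scaled_two_step_def parameter_box_def)
  then have "vz (p $ 3) = vz (q $ 3)" by (simp add: two_step_eq vec_eq_iff forall_3)
  then have "cos (p $ 3) = cos (q $ 3)" using r_pos sin_step_pos by (simp add: vz_def)
  then have 3: "p $ 3 = q $ 3" using cos_inj_on_half_turn[of _ k] p q k by (auto simp: parameter_box_def)
  define x y where "x = vx (p $ 3)" "y = vy (p $ 3)"
  have "y \<noteq> 0" using sin_nonzero_half_turn[of "p $ 3" k] p k r_pos sin_step_pos
    by (auto simp: x_y_def vy_def parameter_box_def)
  then have xy: "x\<^sup>2 + y\<^sup>2 \<noteq> 0" by (simp add: sum_power2_eq_zero_iff)
  have e: "cos (p $ 2) * x - sin (p $ 2) * y = cos (q $ 2) * x - sin (q $ 2) * y"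
       "sin (p $ 2) * x + cos (p $ 2) * y = sin (q $ 2) * x + cos (q $ 2) * y"
    using ts by (simp_all add: two_step_eq vec_eq_iff forall_3 3 x_y_def)
  have "(x\<^sup>2 + y\<^sup>2) * (cos (p $ 2) - cos (q $ 2)) = 0" "(x\<^sup>2 + y\<^sup>2) * (sin (p $ 2) - sin (q $ 2)) = 0"
    using e by algebra+
  then have "cos (p $ 2) = cos (q $ 2)" "sin (p $ 2) = sin (q $ 2)" using xy by auto
  then have "cos (p $ 2 - q $ 2) = 1" using sin_cos_squared_add3[of "q $ 2"] by (simp add: cos_diff)
  then obtain n :: int where n: "p $ 2 - q $ 2 = of_int n * (2 * pi)"
    by (auto simp: cos_one_2pi_int)
  have "\<bar>of_int n * (2 * pi)\<bar> < 2 * pi" unfolding n[symmetric] using p q by (auto simp: parameter_box_def)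
  then have "\<bar>of_int n :: real\<bar> < 1" by (simp add: abs_mult)
  then have "n = 0" by linarith
  then have 2: "p $ 2 = q $ 2" using n by simp
  show "p = q" using 1 2 3 by (simp add: vec_eq_iff forall_3)
qed

text \<open>
  The change of variables formula for the indicator function of \<open>Z\<close>: its integral over the image
  is 0, hence so is the integral of the Jacobian over the preimage, and the Jacobian is nonzero.
\<close>

lemma negligible_preimage_box:
  assumes Z: "negligible Z" and k: "k \<in> {0, 1}"
  shows "negligible {p \<in> parameter_box k. scaled_two_step p \<in> Z}"
proof -
  let ?S = "parameter_box k"
  define d where "d p = \<bar>det (matrix (\<lambda>h. jacobian p *v h))\<bar>" for p
  have d_nonneg: "0 \<le> d p" for p unfolding d_def by (rule abs_ge_zero)
  have d_nonzero: "d p \<noteq> 0" if "p \<in> ?S" for p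
  proof -
    have "sin (p $ 3) \<noteq> 0" "p $ 1 \<noteq> 0"
      using that sin_nonzero_half_turn[OF _ k] by (auto simp: parameter_box_def)
    then show ?thesis
      unfolding d_def matrix_of_matrix_vector_mul det_jacobian using r_pos sin_step_pos by simp
  qed
  let ?f = "\<lambda>x. if x \<in> Z then (1::real^1) else 0"
  have S: "?S \<in> sets lebesgue" by (simp add: parameter_box_eq)
  have hi: "(?f has_integral 0) (scaled_two_step ` ?S)"
    by (rule has_integral_negligible[OF Z]) auto
  moreover have "((\<lambda>x. norm (?f x)) has_integral 0) (scaled_two_step ` ?S)"
    by (rule has_integral_negligible[OF Z]) auto
  ultimately have "?f absolutely_integrable_on (scaled_two_step ` ?S) \<and> integral (scaled_two_step ` ?S) ?f = 0"
    unfolding absolutely_integrable_on_def using has_integral_iff by blast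
  then have ai: "(\<lambda>p. d p *\<^sub>R ?f (scaled_two_step p)) absolutely_integrable_on ?S"
    and i0: "integral ?S (\<lambda>p. d p *\<^sub>R ?f (scaled_two_step p)) = 0"
    using has_absolute_integral_change_of_variables[OF S has_derivative_scaled_two_step inj_on_scaled_two_step[OF k], of ?f 0]
    unfolding d_def by blast+
  let ?h = "\<lambda>p. d p * (if scaled_two_step p \<in> Z then 1 else 0)"
  have h: "?h = (\<lambda>p. (d p *\<^sub>R ?f (scaled_two_step p)) $ 1)" by (rule ext) simp
  have "((\<lambda>p. d p *\<^sub>R ?f (scaled_two_step p)) has_integral 0) ?S"
    using ai i0 by (simp add: absolutely_integrable_on_def has_integral_integrable_integral)
  from has_integral_linear[OF this bounded_linear_vec_nth[of 1]]
  have "((\<lambda>p. (d p *\<^sub>R ?f (scaled_two_step p)) $ 1) has_integral 0) ?S"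
    by (simp only: o_def zero_index)
  then have "integral ?S ?h = 0" unfolding h by (simp add: integral_unique)
  moreover have hai: "?h absolutely_integrable_on ?S"
    unfolding h using absolutely_integrable_linear[OF ai bounded_linear_vec_nth[of 1]] by (simp add: o_def)
  ultimately have "(\<integral>p. indicator ?S p *\<^sub>R ?h p \<partial>lebesgue) = 0"
    using set_lebesgue_integral_eq_integral(2)[OF hai] by (simp add: set_lebesgue_integral_def)
  then have "AE p in lebesgue. indicator ?S p *\<^sub>R ?h p = 0"
    using hai by (subst (asm) integral_nonneg_eq_0_iff_AE) (auto simp: set_integrable_def d_nonneg)
  then obtain N where N: "{p \<in> space lebesgue. \<not> indicator ?S p *\<^sub>R ?h p = 0} \<subseteq> N"
    "emeasure lebesgue N = 0" "N \<in> sets lebesgue"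
    by (rule AE_E)
  have "{p \<in> ?S. ?h p \<noteq> 0} \<subseteq> {p \<in> space lebesgue. \<not> indicator ?S p *\<^sub>R ?h p = 0}"
    by (rule subsetI) (simp add: indicator_def split: if_splits)
  with N(1) have "{p \<in> ?S. ?h p \<noteq> 0} \<subseteq> N" by (rule order_trans[rotated])
  moreover have "negligible N" using N(2,3) by (simp add: negligible_iff_null_sets null_sets_def)
  ultimately have "negligible {p \<in> ?S. ?h p \<noteq> 0}" by (rule negligible_subset[rotated])
  moreover have "{p \<in> ?S. ?h p \<noteq> 0} = {p \<in> ?S. scaled_two_step p \<in> Z}"
    using d_nonzero by auto
  ultimately show ?thesis by simp
qed
end

section \<open>Absolute continuity of two-step walks\<close>

text \<open>
  Otherwise there would be sets of summably small \<open>N\<close>-measure and \<open>M\<close>-measure at least \<open>e\<close>. Their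
  limit superior is an \<open>N\<close>-null set by Borel-Cantelli, but its \<open>M\<close>-measure is at least \<open>e\<close>.
\<close>

lemma absolutely_continuous_eps_delta:
  fixes M N :: "'a measure"
  assumes "finite_measure M" "sets M = sets N"
    and ac: "\<And>Z. Z \<in> null_sets N \<Longrightarrow> Z \<in> null_sets M" and e: "e > 0"
  obtains d where "d > 0" "\<And>B. \<lbrakk>B \<in> sets N; emeasure N B < ennreal d\<rbrakk> \<Longrightarrow> measure M B < e"
proof -
  interpret finite_measure M by fact
  have "\<exists>d>0. \<forall>B\<in>sets N. emeasure N B < ennreal d \<longrightarrow> measure M B < e"
  proof (rule ccontr)
    assume "\<not> ?thesis"
    then have "\<forall>n. \<exists>B\<in>sets N. emeasure N B < ennreal ((1/2)^n) \<and> e \<le> measure M B"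
      by (metis not_le half_gt_zero_iff zero_less_one zero_less_power)
    then obtain B where B: "\<And>n. B n \<in> sets N" "\<And>n. emeasure N (B n) < ennreal ((1/2)^n)" "\<And>n. e \<le> measure M (B n)"
      by metis
    have fin: "emeasure N (B n) < \<infinity>" for n using B(2)[of n] by (simp add: order.strict_trans)
    have "measure N (B n) \<le> (1/2)^n" for n
      using B(2)[of n] by (simp add: measure_def enn2real_leI less_imp_le)
    then have "summable (\<lambda>n. measure N (B n))"
      by (intro summable_comparison_test[OF _ summable_geometric[of "1/2::real"]]) auto
    then have "limsup B \<in> null_sets N" using B(1) fin by (intro borel_cantelli_limsup1) auto
    then have "limsup B \<in> null_sets M" by (rule ac)
    then have 0: "measure M (limsup B) = 0" by (simp add: measure_eq_0_null_sets)
    let ?A = "\<lambda>n. \<Union>k\<in>{n..}. B k"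
    have A: "?A n \<in> sets M" for n using B(1) assms(2) by auto
    have "(\<lambda>n. measure M (?A n)) \<longlonglongrightarrow> measure M (\<Inter>n. ?A n)"
      by (rule finite_Lim_measure_decseq) (use A in \<open>auto simp: decseq_def intro: order_trans\<close>)
    moreover have "e \<le> measure M (?A n)" for n
      using B(3)[of n] A finite_measure_mono[of "B n" "?A n"] by force
    ultimately have "e \<le> measure M (\<Inter>n. ?A n)" by (intro LIMSEQ_le_const) auto
    moreover have "(\<Inter>n. ?A n) = limsup B" by (auto simp: limsup_INF_SUP)
    ultimately show False using 0 e by simp
  qed
  then show ?thesis using that by blast
qed

text \<open>
  A random scaling factor, which spreads a point of the sphere over a ray. It replaces surface
  measure by Lebesgue measure on the open cone over a set.
\<close>

definition unit_time :: "real measure" where "unit_time = uniform_measure lborel {0<..<1}"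

lemma sets_unit_time [simp, measurable_cong]: "sets unit_time = sets borel"
  and space_unit_time [simp]: "space unit_time = UNIV"
  by (simp_all add: unit_time_def)

lemma prob_space_unit_time: "prob_space unit_time"
  unfolding unit_time_def by (rule prob_space_uniform_measure) auto

interpretation time: prob_space unit_time by (rule prob_space_unit_time)
interpretation angles: pair_prob_space angle_measure angle_measure ..
interpretation time_angles: pair_prob_space unit_time "angle_measure \<Otimes>\<^sub>M angle_measure" ..

definition vec3 :: "real \<times> real \<times> real \<Rightarrow> real^3" where
  "vec3 = (\<lambda>(a, b, c). vector [a, b, c])"

lemma vec3_nth [simp]: "vec3 (a, b, c) $ 1 = a" "vec3 (a, b, c) $ 2 = b" "vec3 (a, b, c) $ 3 = c"
  by (simp_all add: vec3_def)

lemma continuous_on_vec3: "continuous_on UNIV vec3"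
proof -
  have "continuous_on UNIV (\<lambda>x. vec3 x $ i)" for i
    using exhaust_3[of i] by (auto simp: vec3_def split_beta) (intro continuous_intros)+
  then have "continuous_on UNIV (\<lambda>x. \<chi> i. vec3 x $ i)" by (rule continuous_on_vec_lambda)
  then show ?thesis by simp
qed

lemma vec3_measurable [measurable]: "vec3 \<in> borel_measurable borel"
  by (rule borel_measurable_continuous_onI[OF continuous_on_vec3])

text \<open>
  The change of variables formula concerns vectors, whereas Fubini's theorem concerns product
  measures; this identity translates null sets between them.
\<close>

lemma lborel_eq_distr_vec3: "distr lborel borel vec3 = lborel"
proof (rule lborel_eqI[symmetric])
  fix l u :: "real^3" assume lu: "\<And>b. b \<in> Basis \<Longrightarrow> l \<bullet> b \<le> u \<bullet> b"
  then have le: "l $ i \<le> u $ i" for i using lu[of "axis i 1"] by (auto simp: Basis_vec_def inner_axis)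
  have "vec3 -` box l u = {l$1<..<u$1} \<times> {l$2<..<u$2} \<times> {l$3<..<u$3}"
    by (auto simp: mem_box_cart forall_3)
  then have "emeasure (distr lborel borel vec3) (box l u) =
      emeasure (lborel \<Otimes>\<^sub>M lborel) ({l$1<..<u$1} \<times> {l$2<..<u$2} \<times> {l$3<..<u$3})"
    by (subst emeasure_distr) (auto simp: lborel_prod)
  also have "\<dots> = emeasure lborel {l$1<..<u$1} * emeasure lborel ({l$2<..<u$2} \<times> {l$3<..<u$3})"
    by (rule lborel.emeasure_pair_measure_Times) (auto intro!: borel_open open_Times)
  also have "emeasure lborel ({l$2<..<u$2} \<times> {l$3<..<u$3})
      = emeasure (lborel \<Otimes>\<^sub>M lborel) ({l$2<..<u$2} \<times> {l$3<..<u$3})"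
    by (simp add: lborel_prod)
  also have "emeasure (lborel \<Otimes>\<^sub>M lborel) ({l$2<..<u$2} \<times> {l$3<..<u$3})
      = emeasure lborel {l$2<..<u$2} * emeasure lborel {l$3<..<u$3}"
    by (rule lborel.emeasure_pair_measure_Times) auto
  also have "emeasure lborel {l$1<..<u$1} * (emeasure lborel {l$2<..<u$2} * emeasure lborel {l$3<..<u$3}) = ennreal ((u$1 - l$1) * ((u$2 - l$2) * (u$3 - l$3)))"
    using le by (simp add: ennreal_mult)
  also have "(u$1 - l$1) * ((u$2 - l$2) * (u$3 - l$3)) = (\<Prod>i\<in>(UNIV::3 set). (u - l) $ i)"
    unfolding UNIV_3 by (simp add: mult.assoc del: One_nat_def)
  also have "\<dots> = (\<Prod>b\<in>Basis. (u - l) \<bullet> b)"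
  proof -
    have B: "Basis = (\<lambda>i::3. axis i (1::real)) ` UNIV" by (auto simp: Basis_vec_def)
    have inj: "inj (\<lambda>i::3. axis i (1::real))" by (auto simp: inj_on_def axis_eq_axis)
    show ?thesis unfolding B prod.reindex[OF inj] o_def by (simp add: inner_axis)
  qed
  finally show "emeasure (distr lborel borel vec3) (box l u) = ennreal (\<Prod>b\<in>Basis. (u - l) \<bullet> b)" .
qed simp

lemma norm_matrix_vector_le:
  "\<exists>K>0. \<forall>(A::real^3^3) x. norm (A *v x) \<le> norm A * norm x * K"
proof -
  have "bounded_bilinear (\<lambda>(A::real^3^3) (x::real^3). A *v x)"
    unfolding bilinear_conv_bounded_bilinear[symmetric] bilinear_def
    by (auto intro!: linearI simp: matrix_vector_mult_add_rdistrib matrix_vector_right_distrib scaleR_matrix_vector_assoc matrix_vector_mult_scaleR)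
  then show ?thesis by (rule bounded_bilinear.pos_bounded)
qed

lemma continuous_on_matrix_vector_mult [continuous_intros]:
  fixes A :: "'a::topological_space \<Rightarrow> real^3^3"
  assumes "continuous_on S A" "continuous_on S x"
  shows "continuous_on S (\<lambda>t. A t *v x t)"
  unfolding matrix_vector_mult_def using assms by (intro continuous_intros)

lemma continuous_on_matrix_mult [continuous_intros]:
  fixes A :: "'a::topological_space \<Rightarrow> real^3^3"
  assumes "continuous_on S A" "continuous_on S B"
  shows "continuous_on S (\<lambda>t. A t ** B t :: real^3^3)"
  unfolding matrix_matrix_mult_def using assms by (intro continuous_intros)

lemma continuous_on_rot' [continuous_intros]:
  "continuous_on S f \<Longrightarrow> continuous_on S (\<lambda>x. rot (f x))"
  using continuous_on_compose2[OF continuous_on_rot] by blast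

lemma emeasure_lborel_orthogonal_vimage:
  fixes g :: "real^3^3"
  assumes g: "orthogonal_matrix g" and D: "D \<in> sets borel" "emeasure lborel D < \<infinity>"
  shows "emeasure lborel {x. g *v x \<in> D} = emeasure lborel D"
proof -
  let ?f = "\<lambda>x. transpose g *v x"
  have ot: "orthogonal_transformation ?f"
    using g unfolding orthogonal_transformation_matrix
    by (simp only: matrix_of_matrix_vector_mul orthogonal_matrix_transpose matrix_vector_mul_linear simp_thms)
  have inv: "?f (g *v x) = x" "g *v ?f x = x" for x
    using g unfolding matrix_vector_mul_assoc orthogonal_matrix_def by simp_all
  have eq: "{x. g *v x \<in> D} = ?f ` D"
  proof (intro set_eqI iffI)
    fix x assume "x \<in> {x. g *v x \<in> D}"
    then show "x \<in> ?f ` D"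
      by (intro image_eqI[of _ _ "g *v x"]) (simp_all only: inv mem_Collect_eq)
  next
    fix x assume "x \<in> ?f ` D"
    then show "x \<in> {x. g *v x \<in> D}" by (elim imageE) (simp only: inv mem_Collect_eq)
  qed
  have L: "D \<in> lmeasurable" using D by (auto simp: fmeasurable_def)
  have m: "{x. g *v x \<in> D} \<in> sets borel"
  proof -
    have "(\<lambda>x. g *v x) \<in> borel_measurable borel" by (intro borel_measurable_continuous_onI continuous_intros)
    then show ?thesis using D by measurable
  qed
  have "emeasure lebesgue (?f ` D) = emeasure lebesgue D"
    unfolding emeasure_eq_measure2[OF L] emeasure_eq_measure2[OF measurable_orthogonal_image[OF ot L]]
      measure_orthogonal_image[OF ot L] ..
  then show ?thesis using m D unfolding eq by simp
qed

lemma radial_cone_borel: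
  assumes "X \<in> sets borel"
  shows "{x \<in> ball 0 r - {0}. radial_projection r x \<in> X} \<in> sets borel"
proof -
  have [measurable]: "radial_projection r \<in> borel_measurable borel"
    unfolding radial_projection_def by measurable
  have eq: "{x \<in> ball 0 r - {0}. radial_projection r x \<in> X}
      = (ball 0 r - {0}) \<inter> (radial_projection r -` X \<inter> space borel)" by auto
  show ?thesis unfolding eq
    by (intro sets.Int sets.Diff measurable_sets[of _ borel borel]) (simp_all add: assms)
qed

context unit_distance_sphere
begin

lemma two_step_continuous: "continuous_on UNIV (\<lambda>x. two_step (fst x) (snd x))"
  unfolding two_step_def by (intro continuous_intros)

lemma two_step_measurable [measurable (raw)]:
  assumes "f \<in> borel_measurable M" "h \<in> borel_measurable M"
  shows "(\<lambda>x. two_step (f x) (h x)) \<in> borel_measurable M"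
  by (rule borel_measurable_continuous_Pair[OF assms two_step_continuous])

lemma AE_scaled_two_step_notin_null:
  assumes Z: "Z \<in> null_sets lborel"
  shows "AE x in unit_time \<Otimes>\<^sub>M (angle_measure \<Otimes>\<^sub>M angle_measure).
    fst x *\<^sub>R two_step (fst (snd x)) (snd (snd x)) \<notin> Z"
proof -
  have Zb [measurable]: "Z \<in> sets borel" using Z by auto
  define N where "N = {p \<in> parameter_box 0 \<union> parameter_box 1. scaled_two_step p \<in> Z}"
  have "negligible Z" using Z by (simp add: negligible_iff_null_sets null_sets_completionI)
  then have "negligible ({p \<in> parameter_box 0. scaled_two_step p \<in> Z} \<union> {p \<in> parameter_box 1. scaled_two_step p \<in> Z})"
    by (intro negligible_Un negligible_preimage_box) auto
  moreover have "N = {p \<in> parameter_box 0. scaled_two_step p \<in> Z} \<union> {p \<in> parameter_box 1. scaled_two_step p \<in> Z}"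
    by (auto simp: N_def)
  ultimately have "negligible N" by simp
  then have "AE p in lebesgue. p \<notin> N" by (simp add: negligible_iff_null_sets AE_not_in)
  then have "AE p in lborel. p \<notin> N" by (simp add: AE_completion_iff)
  moreover have [measurable]: "N \<in> sets borel"
  proof -
    have [measurable]: "parameter_box k \<in> sets borel" for k by (simp add: parameter_box_eq)
    have [measurable]: "scaled_two_step \<in> borel_measurable borel"
      unfolding scaled_two_step_def by measurable
    have "N = (parameter_box 0 \<union> parameter_box 1) \<inter> (scaled_two_step -` Z \<inter> space borel)" by (auto simp: N_def)
    then show ?thesis by simp
  qed
  ultimately have "AE q in lborel. vec3 q \<notin> N"
    by (subst (asm) lborel_eq_distr_vec3[symmetric], subst (asm) AE_distr_iff) auto
  then have "AE q in lborel \<Otimes>\<^sub>M lborel. vec3 q \<notin> N" unfolding lborel_prod .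
  then have "AE t in lborel. AE q in lborel. vec3 (t, q) \<notin> N"
    by (rule lborel_pair.AE_pair)
  then have "AE t in lborel. AE q in lborel \<Otimes>\<^sub>M lborel. vec3 (t, q) \<notin> N" unfolding lborel_prod .
  then have "AE t in lborel. AE \<phi> in lborel. AE \<psi> in lborel. vec3 (t, \<phi>, \<psi>) \<notin> N"
    by eventually_elim (rule lborel_pair.AE_pair)
  moreover have "AE \<phi> in lborel. \<phi> \<noteq> (0::real)" "AE \<psi> in lborel. \<psi> \<noteq> (0::real) \<and> \<psi> \<noteq> pi"
    using AE_lborel_singleton[of "0::real"] AE_lborel_singleton[of pi] by auto
  note nz = this
  have step: "AE \<phi> in angle_measure. AE \<psi> in angle_measure. t *\<^sub>R two_step \<phi> \<psi> \<notin> Z"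
    if t: "t \<in> {0<..<1}" and ae: "AE \<phi> in lborel. AE \<psi> in lborel. vec3 (t, \<phi>, \<psi>) \<notin> N" for t
    unfolding angle_measure_def
  proof (rule AE_uniform_measureI)
    show "AE \<phi> in lborel. \<phi> \<in> {0..<2 * pi} \<longrightarrow>
       (AE \<psi> in uniform_measure lborel {0..<2 * pi}. t *\<^sub>R two_step \<phi> \<psi> \<notin> Z)"
      using ae nz(1)
    proof eventually_elim
      case (elim \<phi>)
      show ?case
      proof (intro impI AE_uniform_measureI)
        assume \<phi>: "\<phi> \<in> {0..<2*pi}"
        show "AE \<psi> in lborel. \<psi> \<in> {0..<2 * pi} \<longrightarrow> t *\<^sub>R two_step \<phi> \<psi> \<notin> Z"
          using elim(1) nz(2)
        proof eventually_elim
          case (elim \<psi>)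
          show ?case
          proof
            assume \<psi>: "\<psi> \<in> {0..<2*pi}"
            have "vec3 (t, \<phi>, \<psi>) \<in> parameter_box 0 \<union> parameter_box 1"
              using t \<phi> \<psi> elim(2) \<open>\<phi> \<noteq> 0\<close> by (auto simp: parameter_box_def)
            then show "t *\<^sub>R two_step \<phi> \<psi> \<notin> Z"
              using elim(1) by (auto simp: N_def scaled_two_step_def)
          qed
        qed
      qed auto
    qed
  qed auto
  have "AE t in unit_time. AE q in angle_measure \<Otimes>\<^sub>M angle_measure. t *\<^sub>R two_step (fst q) (snd q) \<notin> Z"
    unfolding unit_time_def
  proof (rule AE_uniform_measureI)
    show "AE t in lborel. t \<in> {0<..<1} \<longrightarrow>
        (AE q in angle_measure \<Otimes>\<^sub>M angle_measure. t *\<^sub>R two_step (fst q) (snd q) \<notin> Z)"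
      using \<open>AE t in lborel. AE \<phi> in lborel. AE \<psi> in lborel. vec3 (t, \<phi>, \<psi>) \<notin> N\<close>
    proof eventually_elim
      case (elim t)
      show ?case
      proof
        assume "t \<in> {0<..<1}"
        from step[OF this elim]
        show "AE q in angle_measure \<Otimes>\<^sub>M angle_measure. t *\<^sub>R two_step (fst q) (snd q) \<notin> Z"
          by (intro angles.AE_pair_measure, measurable)
      qed
    qed
  qed simp
  then show ?thesis
    by (intro time_angles.AE_pair_measure, measurable)
qed

lemma scaled_two_step_law_small:
  assumes "e > 0"
  obtains d where "d > 0" "\<And>B. \<lbrakk>B \<in> sets borel; emeasure lborel B < ennreal d\<rbrakk> \<Longrightarrow>
    measure (unit_time \<Otimes>\<^sub>M (angle_measure \<Otimes>\<^sub>M angle_measure))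
      {x. fst x *\<^sub>R two_step (fst (snd x)) (snd (snd x)) \<in> B} < e"
proof -
  let ?T = "unit_time \<Otimes>\<^sub>M (angle_measure \<Otimes>\<^sub>M angle_measure)"
  let ?f = "\<lambda>x. fst x *\<^sub>R two_step (fst (snd x)) (snd (snd x))"
  have [measurable]: "?f \<in> borel_measurable ?T" by measurable
  let ?L = "distr ?T borel ?f"
  have fm: "finite_measure ?L" by (rule time_angles.finite_measure_distr) measurable
  have spT: "space ?T = UNIV" by (auto simp: space_pair_measure)
  have mL: "measure ?L B = measure ?T {x. ?f x \<in> B}" if "B \<in> sets borel" for B
    using that by (subst measure_distr) (auto simp: spT vimage_def)
  have "Z \<in> null_sets ?L" if Z: "Z \<in> null_sets lborel" for Z
  proof -
    have [measurable]: "Z \<in> sets borel" using Z by auto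
    have "AE x in ?L. x \<notin> Z"
      by (subst AE_distr_iff) (use AE_scaled_two_step_notin_null[OF Z] in auto)
    then show ?thesis by (subst AE_iff_null_sets) auto
  qed
  from absolutely_continuous_eps_delta[where N = lborel, OF fm _ this assms]
  obtain d where d: "d > 0" "\<And>B. \<lbrakk>B \<in> sets lborel; emeasure lborel B < ennreal d\<rbrakk> \<Longrightarrow> measure ?L B < e"
    by auto
  show ?thesis
  proof (rule that[OF d(1)])
    fix B :: "(real^3) set" assume "B \<in> sets borel" "emeasure lborel B < ennreal d"
    then show "measure ?T {x. ?f x \<in> B} < e" using d(2)[of B] mL[of B] by simp
  qed
qed

text \<open>
  The smoothing property of two steps: moving the frame slightly makes the two-step point enter or
  leave \<open>E\<close> only with small probability, however irregular \<open>E\<close> is. The cone \<open>C\<close> over \<open>E\<close> is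
  squeezed between a compact set \<open>K\<close> and an open set \<open>U\<close> whose difference has small Lebesgue measure.
  If the frames are close, then points at which the two memberships differ are sent into \<open>U - K\<close> by one
  of them, and by absolute continuity and orthogonal invariance that is unlikely, uniformly in the
  frames.
\<close>

lemma two_step_uniformly_continuous_in_measure:
  assumes E: "E \<in> sets borel" "E \<subseteq> sphere 0 r" and e: "e > 0"
  obtains d where "d > 0" "\<And>g g'. \<lbrakk>orthogonal_matrix g; orthogonal_matrix g'; norm (g - g') < d\<rbrakk> \<Longrightarrow>
    measure (angle_measure \<Otimes>\<^sub>M angle_measure)
      {x. (g *v two_step (fst x) (snd x) \<in> E) \<noteq> (g' *v two_step (fst x) (snd x) \<in> E)} < e"
proof -
  let ?A = "angle_measure \<Otimes>\<^sub>M angle_measure :: (real \<times> real) measure"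
  let ?T = "unit_time \<Otimes>\<^sub>M ?A"
  let ?f = "\<lambda>x::real \<times> real \<times> real. fst x *\<^sub>R two_step (fst (snd x)) (snd (snd x))"
  have [measurable]: "?f \<in> borel_measurable ?T" by measurable
  have spT: "space ?T = UNIV" and spA: "space ?A = UNIV" by (auto simp: space_pair_measure)
  obtain \<eta> where \<eta>: "\<eta> > 0" "\<And>B. \<lbrakk>B \<in> sets borel; emeasure lborel B < ennreal \<eta>\<rbrakk> \<Longrightarrow> measure ?T {x. ?f x \<in> B} < e / 2"
    using scaled_two_step_law_small[OF half_gt_zero[OF e]] by blast
  have [measurable]: "E \<in> sets borel" by fact
  define C where "C = {x \<in> ball 0 r - {0}. radial_projection r x \<in> E}"
  have Cb: "C \<in> sets borel" unfolding C_def by (rule radial_cone_borel[OF E(1)])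
  have CE: "t *\<^sub>R w \<in> C \<longleftrightarrow> w \<in> E" if "t \<in> {0<..<1}" "norm w = r" for t and w :: "real^3"
  proof -
    have "w \<noteq> 0" using that r_pos by auto
    moreover have "radial_projection r (t *\<^sub>R w) = w" using that r_pos by (simp add: radial_projection_def)
    moreover have "t * r < r" using that r_pos by simp
    ultimately show ?thesis using that r_pos by (auto simp: C_def)
  qed
  have CL: "C \<in> sets lebesgue" using Cb by simp
  obtain U where U: "open U" "C \<subseteq> U" "emeasure lebesgue (U - C) < ennreal (\<eta> / 2)"
    by (rule sets_lebesgue_outer_open[OF CL half_gt_zero[OF \<eta>(1)]])
  obtain K where K: "closed K" "K \<subseteq> C" "emeasure lebesgue (C - K) < ennreal (\<eta> / 2)"
    by (rule sets_lebesgue_inner_closed[OF CL half_gt_zero[OF \<eta>(1)]])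
  define D where "D = U - K"
  have Db: "D \<in> sets borel" using U K by (auto simp: D_def)
  have Deq: "D = (U - C) \<union> (C - K)" using U K by (auto simp: D_def)
  have "emeasure lborel D \<le> emeasure lborel (U - C) + emeasure lborel (C - K)"
    unfolding Deq by (rule emeasure_subadditive) (use U K Cb in auto)
  also have "emeasure lborel (U - C) = emeasure lebesgue (U - C)"
    by (subst emeasure_completion) (use U(1) Cb in simp_all)
  also have "emeasure lborel (C - K) = emeasure lebesgue (C - K)"
    by (subst emeasure_completion) (use K(1) Cb in simp_all)
  also have "emeasure lebesgue (U - C) + emeasure lebesgue (C - K) < ennreal (\<eta> / 2) + ennreal (\<eta> / 2)"
    by (rule add_strict_mono[OF U(3) K(3)])
  also have "\<dots> = ennreal \<eta>" using \<eta>(1) by (simp flip: ennreal_plus)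
  finally have D: "emeasure lborel D < ennreal \<eta>" .
  have "K \<subseteq> ball 0 r" using K(2) unfolding C_def by blast
  then have "compact K"
    using K(1) bounded_subset[OF bounded_ball[of 0 r], of K] by (simp add: compact_eq_bounded_closed)
  then obtain \<delta> where \<delta>: "\<delta> > 0" "(\<Union>x\<in>K. ball x \<delta>) \<subseteq> U"
    using compact_subset_open_imp_ball_epsilon_subset[OF _ U(1) order_trans[OF K(2) U(2)]] by metis
  obtain M where M: "M > 0" "\<And>(A::real^3^3) x. norm (A *v x) \<le> norm A * norm x * M"
    using norm_matrix_vector_le by blast
  show ?thesis
  proof (rule that[of "\<delta> / (r * M)"])
    show "\<delta> / (r * M) > 0" using \<delta> M r_pos by simp
    fix g g' :: "real^3^3"
    assume g: "orthogonal_matrix g" "orthogonal_matrix g'" and close: "norm (g - g') < \<delta> / (r * M)"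
    let ?X = "{x. (g *v two_step (fst x) (snd x) \<in> E) \<noteq> (g' *v two_step (fst x) (snd x) \<in> E)}"
    have gm [measurable]: "(\<lambda>x. h *v x) \<in> borel_measurable borel" for h :: "real^3^3"
      by (intro borel_measurable_continuous_onI continuous_intros)
    have Xm: "?X \<in> sets ?A" 
    proof -
      have "{x \<in> space ?A. (g *v two_step (fst x) (snd x) \<in> E) \<noteq> (g' *v two_step (fst x) (snd x) \<in> E)} \<in> sets ?A"
        by measurable
      then show ?thesis by (simp add: spA)
    qed
    have small: "measure ?T {x. h *v ?f x \<in> D} < e / 2" if h: "orthogonal_matrix h" for h
    proof -
      have "emeasure lborel {x. h *v x \<in> D} = emeasure lborel D"
        using emeasure_lborel_orthogonal_vimage[OF h Db] D by (simp add: order.strict_trans)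
      moreover have "{x. h *v x \<in> D} \<in> sets borel"
        using measurable_sets[OF gm[of h] Db] by (simp add: vimage_def)
      ultimately show ?thesis using \<eta>(2)[of "{x. h *v x \<in> D}"] D by simp
    qed
    have key: "g *v x \<in> D \<or> g' *v x \<in> D"
      if x: "norm x < r" and ne: "(g *v x \<in> C) \<noteq> (g' *v x \<in> C)" for x
    proof -
      have "norm (g *v x - g' *v x) \<le> norm (g - g') * norm x * M"
        using M(2)[of "g - g'" x] by (simp add: matrix_vector_mult_diff_rdistrib)
      also have "\<dots> \<le> norm (g - g') * r * M" using x M by (intro mult_right_mono mult_left_mono) auto
      also have "\<dots> < \<delta>" using close M r_pos by (simp add: field_simps)
      finally have d: "dist (g *v x) (g' *v x) < \<delta>" by (simp add: dist_norm)
      have "g' *v x \<in> U" if "g *v x \<in> K" using \<delta>(2) d that by (auto simp: subset_eq)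
      moreover have "g *v x \<in> U" if "g' *v x \<in> K" using \<delta>(2) d that by (auto simp: subset_eq dist_commute)
      ultimately show ?thesis using ne U(2) K(2) by (auto simp: D_def)
    qed
    have Tm: "{x. h *v ?f x \<in> D} \<in> sets ?T" for h
    proof -
      have "(\<lambda>x. h *v ?f x) \<in> borel_measurable ?T" by measurable
      from measurable_sets[OF this Db] show ?thesis by (simp add: spT vimage_def)
    qed
    have "measure ?A ?X = measure ?T (UNIV \<times> ?X)"
    proof -
      have "emeasure ?T (UNIV \<times> ?X) = emeasure unit_time UNIV * emeasure ?A ?X"
        using Xm angles.sigma_finite_measure_axioms
        by (intro sigma_finite_measure.emeasure_pair_measure_Times) auto
      then show ?thesis using time.emeasure_space_1 unfolding measure_def by simp
    qed
    also have "\<dots> \<le> measure ?T ({x. g *v ?f x \<in> D} \<union> {x. g' *v ?f x \<in> D})"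
    proof (rule time_angles.finite_measure_mono_AE)
      have "AE t in unit_time. t \<in> {0<..<1}"
        unfolding unit_time_def by (rule AE_uniform_measureI) auto
      then have "AE x in ?T. fst x \<in> {0<..<1}"
        by (intro time_angles.AE_pair_measure, measurable)
      then show "AE x in ?T. x \<in> UNIV \<times> ?X \<longrightarrow> x \<in> {x. g *v ?f x \<in> D} \<union> {x. g' *v ?f x \<in> D}"
      proof eventually_elim
        case (elim x)
        show ?case
        proof
          assume x: "x \<in> UNIV \<times> ?X"
          let ?w = "two_step (fst (snd x)) (snd (snd x))"
          have h: "h *v ?f x \<in> C \<longleftrightarrow> h *v ?w \<in> E" if "orthogonal_matrix h" for h
            using CE[OF elim, of "h *v ?w"] that
            by (simp add: norm_orthogonal_matrix norm_two_step matrix_vector_mult_scaleR)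
          have "norm (?f x) < r" using elim r_pos by (simp add: norm_two_step)
          moreover have "(g *v ?f x \<in> C) \<noteq> (g' *v ?f x \<in> C)"
            using x unfolding h[OF g(1)] h[OF g(2)] by auto
          ultimately show "x \<in> {x. g *v ?f x \<in> D} \<union> {x. g' *v ?f x \<in> D}" using key by blast
        qed
      qed
    qed (use Tm in auto)
    also have "\<dots> \<le> measure ?T {x. g *v ?f x \<in> D} + measure ?T {x. g' *v ?f x \<in> D}"
      by (rule measure_Un_le) (rule Tm)+
    also have "\<dots> < e" using small[OF g(1)] small[OF g(2)] by simp
    finally show "measure ?A ?X < e" .
  qed
qed

end

section \<open>Continuity of hitting probabilities\<close>

lemma bounded_orthogonal_matrices: "bounded {g :: real^3^3. orthogonal_matrix g}"
proof (rule boundedI)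
  fix g :: "real^3^3" assume "g \<in> {g. orthogonal_matrix g}"
  then have g: "orthogonal_matrix g" by simp
  have "norm (g $ i) = 1" for i
    using g by (simp add: orthogonal_matrix_orthonormal_rows row_def)
  then have "(\<Sum>i\<in>UNIV. norm (g $ i)) = 3" by simp
  then show "norm g \<le> 3" using L2_set_le_sum[of UNIV "\<lambda>i. norm (g $ i)"] by (simp add: norm_vec_def)
qed

lemma compact_orthogonal_matrices: "compact {g :: real^3^3. orthogonal_matrix g}"
proof -
  have "continuous_on UNIV (\<lambda>g::real^3^3. transpose g ** g)"
    unfolding transpose_def by (intro continuous_intros)
  then have "closed {g::real^3^3. transpose g ** g = mat 1}"
    by (intro closed_Collect_eq continuous_on_const) auto
  then show ?thesis
    using bounded_orthogonal_matrices by (simp add: compact_eq_bounded_closed orthogonal_matrix)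
qed

lemma dist_orthogonal_matrix:
  "orthogonal_matrix (g::real^3^3) \<Longrightarrow> dist (g *v x) (g *v y) = dist x y"
proof -
  assume "orthogonal_matrix g"
  then have "orthogonal_transformation (\<lambda>x. g *v x)"
    by (simp add: orthogonal_transformation_matrix matrix_of_matrix_vector_mul)
  then show ?thesis by (simp add: orthogonal_transformation_isometry[of "\<lambda>x. g *v x"])
qed

lemma orthogonal_right_rot_close:
  assumes "d > 0"
  obtains \<delta> where "\<delta> > 0" "\<And>(g::real^3^3) a. \<lbrakk>orthogonal_matrix g; \<bar>a\<bar> < \<delta>\<rbrakk> \<Longrightarrow> norm (g ** rot a - g) < d"
proof -
  let ?O = "{g :: real^3^3. orthogonal_matrix g}"
  let ?f = "\<lambda>p::(real^3^3) \<times> real. fst p ** rot (snd p)"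
  have "continuous_on (?O \<times> {-1..1}) ?f"
    by (intro continuous_intros)
  moreover have "compact (?O \<times> {-1..1::real})"
    by (intro compact_Times compact_orthogonal_matrices) auto
  ultimately have "uniformly_continuous_on (?O \<times> {-1..1}) ?f" by (rule compact_uniformly_continuous)
  then obtain e where e: "e > 0"
    "\<And>p q. \<lbrakk>p \<in> ?O \<times> {-1..1}; q \<in> ?O \<times> {-1..1}; dist q p < e\<rbrakk> \<Longrightarrow> dist (?f q) (?f p) < d"
    using assms unfolding uniformly_continuous_on_def by metis
  have rot0: "rot 0 = mat 1" by (simp add: matrix_3_simps rot_def)
  show ?thesis
  proof (rule that[of "min e 1"])
    fix g :: "real^3^3" and a assume "orthogonal_matrix g" "\<bar>a\<bar> < min e 1"
    moreover from this have "- 1 \<le> a" "a \<le> 1" by linarith+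
    ultimately show "norm (g ** rot a - g) < d"
      using e(2)[of "(g, 0)" "(g, a)"] by (simp add: dist_Pair_Pair dist_norm rot0)
  qed (use e in simp)
qed

context unit_distance_sphere
begin

text \<open>
  \<open>hit E g\<close> is the proportion of \<open>E\<close> on the circle of points at distance 1 from \<open>g *v pole\<close>, and
  \<open>hit2 E g\<close> is the probability that a random two-step walk from \<open>g *v pole\<close> ends in \<open>E\<close>. They are
  functions of a frame instead of a point, so that all circles come with a parametrization.
\<close>

definition hit :: "(real^3) set \<Rightarrow> real^3^3 \<Rightarrow> real" where
  "hit E g = measure angle_measure {\<phi>. g *v (rot \<phi> *v neighbour) \<in> E}"

definition move :: "real^3^3 \<Rightarrow> real \<Rightarrow> real^3^3" where
  "move g \<phi> = g ** rot \<phi> ** tilt"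

definition hit2 :: "(real^3) set \<Rightarrow> real^3^3 \<Rightarrow> real" where
  "hit2 E g = (\<integral>\<phi>. hit E (move g \<phi>) \<partial>angle_measure)"

lemma orthogonal_move: "orthogonal_matrix g \<Longrightarrow> orthogonal_matrix (move g \<phi>)"
  unfolding move_def by (intro orthogonal_matrix_mul orthogonal_rot orthogonal_tilt)

lemma continuous_on_move: "continuous_on S (move g)"
  unfolding move_def by (intro continuous_intros)

lemma move_rot: "move (g ** rot a) \<phi> = move g (\<phi> + a)"
  by (simp add: move_def matrix_mul_assoc[symmetric] rot_add add.commute)

lemma move_periodic: "move g (\<phi> + 2 * pi) = move g \<phi>"
  by (simp add: move_def rot_periodic)

lemma hit_move: "hit E (move g \<phi>) = measure angle_measure {\<psi>. g *v two_step \<phi> \<psi> \<in> E}"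
  by (simp add: hit_def move_def two_step_def matrix_vector_mul_assoc matrix_mul_assoc)

lemma hit_nonneg: "0 \<le> hit E g" and hit_le_1: "hit E g \<le> 1"
  by (simp_all add: hit_def angle.prob_le_1)

lemma direction_measurable [measurable]:
  "(\<lambda>\<phi>. (g :: real^3^3) *v (rot \<phi> *v neighbour)) \<in> borel_measurable borel"
  by (intro borel_measurable_continuous_onI continuous_on_matrix_vector_mult continuous_on_const continuous_on_rot)

lemma two_step_set_measurable:
  assumes [measurable]: "E \<in> sets borel"
  shows "{x. g *v two_step (fst x) (snd x) \<in> E} \<in> sets (angle_measure \<Otimes>\<^sub>M angle_measure)"
proof -
  have [measurable]: "(\<lambda>x. g *v x) \<in> borel_measurable borel"
    by (intro borel_measurable_continuous_onI continuous_intros)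
  have "{x \<in> space (angle_measure \<Otimes>\<^sub>M angle_measure). g *v two_step (fst x) (snd x) \<in> E}
      \<in> sets (angle_measure \<Otimes>\<^sub>M angle_measure)" by measurable
  then show ?thesis by (simp add: space_pair_measure)
qed

lemma hit_move_measurable [measurable]:
  assumes E: "E \<in> sets borel"
  shows "(\<lambda>\<phi>. hit E (move g \<phi>)) \<in> borel_measurable borel"
proof -
  let ?Q = "{x. g *v two_step (fst x) (snd x) \<in> E}"
  have "(\<lambda>\<phi>. emeasure angle_measure (Pair \<phi> -` ?Q)) \<in> borel_measurable angle_measure"
    by (rule angle.measurable_emeasure_Pair[OF two_step_set_measurable[OF E]])
  then have "(\<lambda>\<phi>. enn2real (emeasure angle_measure (Pair \<phi> -` ?Q))) \<in> borel_measurable angle_measure"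
    by measurable
  then show ?thesis
    by (simp add: hit_move measure_def vimage_def measurable_cong_sets[OF sets_angle_measure refl])
qed

lemma integrable_bounded_angle:
  fixes f :: "real \<Rightarrow> real"
  assumes "f \<in> borel_measurable borel" "\<And>x. \<bar>f x\<bar> \<le> B"
  shows "integrable angle_measure f"
  by (rule angle.integrable_const_bound[of _ B]) (use assms in auto)

lemma integrable_hit_move [simp]:
  "E \<in> sets borel \<Longrightarrow> integrable angle_measure (\<lambda>\<phi>. hit E (move g \<phi>))"
  by (rule integrable_bounded_angle[of _ 1]) (auto simp: hit_nonneg hit_le_1)

text \<open>
  The function \<open>hit E\<close> itself may jump from one point to the next. Its restriction to a circle of
  radius 1, taken as an element of \<open>L\<^sup>1\<close> of the circle, depends continuously on the circle, because
  only two-step walks from the centre enter.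
\<close>

lemma hit_move_L1_uniformly_continuous:
  assumes E: "E \<in> sets borel" "E \<subseteq> sphere 0 r" and e: "e > 0"
  obtains d where "d > 0" "\<And>g g'. \<lbrakk>orthogonal_matrix g; orthogonal_matrix g'; norm (g - g') < d\<rbrakk> \<Longrightarrow>
    (\<integral>\<phi>. \<bar>hit E (move g \<phi>) - hit E (move g' \<phi>)\<bar> \<partial>angle_measure) < e"
proof -
  let ?A = "angle_measure \<Otimes>\<^sub>M angle_measure"
  let ?X = "\<lambda>g g'. {x. (g *v two_step (fst x) (snd x) \<in> E) \<noteq> (g' *v two_step (fst x) (snd x) \<in> E)}"
  obtain d where d: "d > 0" "\<And>g g'. \<lbrakk>orthogonal_matrix g; orthogonal_matrix g'; norm (g - g') < d\<rbrakk> \<Longrightarrow>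
      measure ?A (?X g g') < e"
    using two_step_uniformly_continuous_in_measure[OF E e] by blast
  show ?thesis
  proof (rule that[OF d(1)])
    fix g g' :: "real^3^3"
    assume g: "orthogonal_matrix g" "orthogonal_matrix g'" "norm (g - g') < d"
    let ?P = "\<lambda>g. {x. g *v two_step (fst x) (snd x) \<in> E}"
    have P: "?P g \<in> sets ?A" for g by (rule two_step_set_measurable[OF E(1)])
    have "?X g g' = (?P g - ?P g') \<union> (?P g' - ?P g)" by auto
    then have X: "?X g g' \<in> sets ?A" using P by simp
    let ?m = "\<lambda>\<phi>. measure angle_measure (Pair \<phi> -` ?X g g')"
    have sec: "Pair \<phi> -` Y \<in> sets angle_measure" if "Y \<in> sets ?A" for \<phi> Y
      using sets_Pair1[OF that] .
    have le: "hit E (move h \<phi>) \<le> hit E (move h' \<phi>) + ?m \<phi>"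
      if "h = g \<and> h' = g' \<or> h = g' \<and> h' = g" for h h' \<phi>
    proof -
      have "hit E (move h \<phi>) = measure angle_measure (Pair \<phi> -` ?P h)"
        by (simp add: hit_move vimage_def)
      also have "\<dots> \<le> measure angle_measure (Pair \<phi> -` ?P h' \<union> Pair \<phi> -` ?X g g')"
        by (rule angle.finite_measure_mono) (use that sec[OF P] sec[OF X] in auto)
      also have "\<dots> \<le> measure angle_measure (Pair \<phi> -` ?P h') + ?m \<phi>"
        by (rule measure_Un_le) (use sec[OF P] sec[OF X] in auto)
      also have "measure angle_measure (Pair \<phi> -` ?P h') = hit E (move h' \<phi>)"
        by (simp add: hit_move vimage_def)
      finally show ?thesis .
    qed
    have mm: "?m \<in> borel_measurable borel"
      using angle.measurable_emeasure_Pair[OF X]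
      by (simp add: measure_def measurable_cong_sets[OF sets_angle_measure refl])
    have im: "integrable angle_measure ?m"
      by (rule integrable_bounded_angle[OF mm, of 1]) (simp add: angle.prob_le_1)
    have "(\<integral>\<phi>. \<bar>hit E (move g \<phi>) - hit E (move g' \<phi>)\<bar> \<partial>angle_measure) \<le> (\<integral>\<phi>. ?m \<phi> \<partial>angle_measure)"
    proof (rule integral_mono)
      show "integrable angle_measure (\<lambda>\<phi>. \<bar>hit E (move g \<phi>) - hit E (move g' \<phi>)\<bar>)"
        using E(1) by (intro integrable_abs Bochner_Integration.integrable_diff integrable_hit_move)
      show "\<bar>hit E (move g \<phi>) - hit E (move g' \<phi>)\<bar> \<le> ?m \<phi>" for \<phi>
        using le[of g g' \<phi>] le[of g' g \<phi>] by simp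
    qed (rule im)
    also have "\<dots> = measure ?A (?X g g')"
    proof -
      have "emeasure ?A (?X g g') = (\<integral>\<^sup>+\<phi>. emeasure angle_measure (Pair \<phi> -` ?X g g') \<partial>angle_measure)"
        by (rule angle.emeasure_pair_measure_alt[OF X])
      also have "\<dots> = (\<integral>\<^sup>+\<phi>. ennreal (?m \<phi>) \<partial>angle_measure)"
        by (simp add: angle.emeasure_eq_measure)
      finally show ?thesis
        using im by (subst integral_eq_nn_integral) (auto simp: measure_def)
    qed
    also have "\<dots> < e" by (rule d(2)[OF g])
    finally show "(\<integral>\<phi>. \<bar>hit E (move g \<phi>) - hit E (move g' \<phi>)\<bar> \<partial>angle_measure) < e" .
  qed
qed

text \<open>
  The general Lipschitz function \<open>f\<close> serves for two cases: the identity, and a cut-off function that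
  detects the value 0.
\<close>

lemma integral_lipschitz_hit_continuous:
  assumes E: "E \<in> sets borel" "E \<subseteq> sphere 0 r"
    and f: "f \<in> borel_measurable borel" "K > 0" "\<And>s t. \<bar>f s - f t\<bar> \<le> K * \<bar>s - t\<bar>" "\<And>s. \<bar>f s\<bar> \<le> B + K * \<bar>s\<bar>"
  shows "continuous_on {g. orthogonal_matrix g} (\<lambda>g. \<integral>\<phi>. f (hit E (move g \<phi>)) \<partial>angle_measure)"
  unfolding continuous_on_iff
proof (intro ballI allI impI)
  fix g :: "real^3^3" and e :: real assume g: "g \<in> {g. orthogonal_matrix g}" and e: "e > 0"
  have "e / K > 0" using e f(2) by simp
  from hit_move_L1_uniformly_continuous[OF E this] obtain d where d: "d > 0"
    "\<And>g g'. \<lbrakk>orthogonal_matrix g; orthogonal_matrix g'; norm (g - g') < d\<rbrakk> \<Longrightarrow>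
    (\<integral>\<phi>. \<bar>hit E (move g \<phi>) - hit E (move g' \<phi>)\<bar> \<partial>angle_measure) < e / K" by blast
  note [measurable] = f(1) E(1)
  have int: "integrable angle_measure (\<lambda>\<phi>. f (hit E (move g \<phi>)))" for g
  proof (rule integrable_bounded_angle[of _ "B + K"])
    show "\<bar>f (hit E (move g x))\<bar> \<le> B + K" for x
    proof -
      have "K * \<bar>hit E (move g x)\<bar> \<le> K" using f(2) hit_nonneg hit_le_1 by (simp add: mult_left_le)
      then show ?thesis using f(4)[of "hit E (move g x)"] by linarith
    qed
  qed measurable
  show "\<exists>d>0. \<forall>x'\<in>{g. orthogonal_matrix g}. dist x' g < d \<longrightarrow>
       dist (\<integral>\<phi>. f (hit E (move x' \<phi>)) \<partial>angle_measure) (\<integral>\<phi>. f (hit E (move g \<phi>)) \<partial>angle_measure) < e"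
  proof (intro exI[of _ d] conjI d(1) ballI impI)
    fix h :: "real^3^3" assume h: "h \<in> {g. orthogonal_matrix g}" "dist h g < d"
    have "dist (\<integral>\<phi>. f (hit E (move h \<phi>)) \<partial>angle_measure) (\<integral>\<phi>. f (hit E (move g \<phi>)) \<partial>angle_measure)
        = \<bar>\<integral>\<phi>. f (hit E (move h \<phi>)) - f (hit E (move g \<phi>)) \<partial>angle_measure\<bar>"
      using int by (simp add: dist_real_def)
    also have "\<dots> \<le> (\<integral>\<phi>. \<bar>f (hit E (move h \<phi>)) - f (hit E (move g \<phi>))\<bar> \<partial>angle_measure)"
      using integral_norm_bound[of angle_measure "\<lambda>\<phi>. f (hit E (move h \<phi>)) - f (hit E (move g \<phi>))"] by simp
    also have "\<dots> \<le> (\<integral>\<phi>. K * \<bar>hit E (move h \<phi>) - hit E (move g \<phi>)\<bar> \<partial>angle_measure)"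
      using int E(1) f(3)
      by (intro integral_mono integrable_abs Bochner_Integration.integrable_diff integrable_mult_right integrable_hit_move) auto
    also have "\<dots> = K * (\<integral>\<phi>. \<bar>hit E (move h \<phi>) - hit E (move g \<phi>)\<bar> \<partial>angle_measure)" by simp
    also have "\<dots> < K * (e / K)"
      using d(2)[of h g] g h f(2) by (intro mult_strict_left_mono) (auto simp: dist_norm)
    also have "\<dots> = e" using f(2) by simp
    finally show "dist (\<integral>\<phi>. f (hit E (move h \<phi>)) \<partial>angle_measure) (\<integral>\<phi>. f (hit E (move g \<phi>)) \<partial>angle_measure) < e" .
  qed
qed

lemma hit2_continuous:
  assumes "E \<in> sets borel" "E \<subseteq> sphere 0 r"
  shows "continuous_on {g. orthogonal_matrix g} (hit2 E)"
  using integral_lipschitz_hit_continuous[OF assms, of "\<lambda>x. x" 1 0] by (simp add: hit2_def[abs_def])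

lemma hit2_rot: "E \<in> sets borel \<Longrightarrow> hit2 E (g ** rot a) = hit2 E g"
  unfolding hit2_def move_rot by (rule integral_angle_shift) (simp_all add: move_periodic)

lemma hit2_nonneg: "0 \<le> hit2 E g"
  unfolding hit2_def by (rule Bochner_Integration.integral_nonneg) (rule hit_nonneg)

end

section \<open>Four colours are not enough\<close>

abbreviation colours :: "nat set" where "colours \<equiv> {1..4}"

text \<open>
  Borel kernels of the colour classes cover the sphere only up to a null set. In contrast,
  \<open>E_avoids_1\<close> has no exceptional points, which is why it can be applied on individual circles:
  these are null sets themselves.
\<close>

locale four_colouring = unit_distance_sphere r \<theta> for r \<theta> :: real +
  fixes E :: "nat \<Rightarrow> (real^3) set"
  assumes E_borel [measurable]: "E i \<in> sets borel"
    and E_sphere: "E i \<subseteq> sphere 0 r"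
    and E_disjoint: "i \<noteq> j \<Longrightarrow> E i \<inter> E j = {}"
    and E_avoids_1: "\<lbrakk>x \<in> E i; y \<in> E i\<rbrakk> \<Longrightarrow> dist x y \<noteq> 1"
    and E_cover: "{x \<in> ball 0 r - {0}. radial_projection r x \<notin> (\<Union>i\<in>colours. E i)} \<in> null_sets lborel"
    and odd_near_turn: "\<And>e. e > 0 \<Longrightarrow> \<exists>m l. odd (m::nat) \<and> \<bar>real m * \<theta> - 2 * pi * of_int l\<bar> < e"
begin

definition coloured :: "(real^3) set" where "coloured = (\<Union>i\<in>colours. E i)"

definition around :: "real^3^3 \<Rightarrow> real \<Rightarrow> real^3" where
  "around g \<phi> = g *v (rot \<phi> *v neighbour)"

text \<open>
  A null set on the sphere may contain whole circles, so this condition can fail for some frames;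
  by absolute continuity of two-step walks it holds after almost every step.
\<close>

definition circle_coloured :: "real^3^3 \<Rightarrow> bool" where
  "circle_coloured g \<longleftrightarrow> (AE \<phi> in angle_measure. around g \<phi> \<in> coloured)"

lemma coloured_borel [measurable]: "coloured \<in> sets borel"
  unfolding coloured_def by measurable

lemma around_measurable [measurable]: "around g \<in> borel_measurable borel"
  unfolding around_def[abs_def] by measurable

lemma around_periodic: "around g (\<phi> + 2 * pi) = around g \<phi>"
  by (simp add: around_def rot_periodic)

lemma around_move: "around (move g \<phi>) \<psi> = g *v two_step \<phi> \<psi>"
  by (simp add: around_def move_def two_step_def matrix_vector_mul_assoc matrix_mul_assoc)

lemma hit_around: "hit E' g = measure angle_measure {\<phi>. around g \<phi> \<in> E'}"
  by (simp add: hit_def around_def)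

lemma dist_around_theta:
  "orthogonal_matrix g \<Longrightarrow> dist (around g \<phi>) (around g (\<phi> + \<theta>)) = 1"
  unfolding around_def by (simp add: dist_orthogonal_matrix dist_rot_neighbour_theta)

lemma dist_around_move:
  assumes g: "orthogonal_matrix g"
  shows "dist (around g \<phi>) (around (move g \<phi>) \<psi>) = 1"
proof -
  have "around g \<phi> = g *v (rot \<phi> *v (tilt *v pole))" by (simp add: around_def neighbour_def)
  then show ?thesis unfolding around_move two_step_def
    by (simp only: dist_orthogonal_matrix[OF g] dist_orthogonal_matrix[OF orthogonal_rot]
        dist_orthogonal_matrix[OF orthogonal_tilt] dist_pole_rot_neighbour)
qed

lemma hit_own_colour:
  assumes "orthogonal_matrix g" "around g \<phi> \<in> E i"
  shows "hit (E i) (move g \<phi>) = 0"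
proof -
  have "{\<psi>. around (move g \<phi>) \<psi> \<in> E i} = {}"
    using E_avoids_1[OF assms(2)] dist_around_move[OF assms(1)] by blast
  then show ?thesis by (simp add: hit_around)
qed

lemma AE_circle_coloured_move:
  assumes g: "orthogonal_matrix g"
  shows "AE \<phi> in angle_measure. circle_coloured (move g \<phi>)"
proof -
  let ?Z = "{x \<in> ball 0 r - {0}. radial_projection r x \<notin> coloured}"
  let ?A = "angle_measure \<Otimes>\<^sub>M angle_measure"
  have Z: "?Z \<in> null_sets lborel" using E_cover by (simp add: coloured_def)
  have Zb: "?Z \<in> sets borel" using Z by auto
  have gm [measurable]: "(\<lambda>x. g *v x) \<in> borel_measurable borel"
    by (intro borel_measurable_continuous_onI continuous_intros)
  have "emeasure lborel {x. g *v x \<in> ?Z} = 0"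
    using emeasure_lborel_orthogonal_vimage[OF g Zb] Z by auto
  moreover have "{x. g *v x \<in> ?Z} \<in> sets borel"
    using measurable_sets[OF gm Zb] by (simp add: vimage_def)
  ultimately have "{x. g *v x \<in> ?Z} \<in> null_sets lborel" by (simp add: null_sets_def)
  from AE_scaled_two_step_notin_null[OF this]
  have "AE t in unit_time. AE q in ?A. t *\<^sub>R two_step (fst q) (snd q) \<notin> {x. g *v x \<in> ?Z}"
    using time_angles.AE_pair[of "\<lambda>x. fst x *\<^sub>R two_step (fst (snd x)) (snd (snd x)) \<notin> {x. g *v x \<in> ?Z}"]
    by simp
  moreover have "AE t in unit_time. t \<in> {0<..<1}"
    unfolding unit_time_def by (rule AE_uniform_measureI) auto
  ultimately have "AE t in unit_time. t \<in> {0<..<1} \<and>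
      (AE q in ?A. t *\<^sub>R two_step (fst q) (snd q) \<notin> {x. g *v x \<in> ?Z})"
    by eventually_elim blast
  then obtain t where t: "t \<in> {0<..<1}" and ae: "AE q in ?A. t *\<^sub>R two_step (fst q) (snd q) \<notin> {x. g *v x \<in> ?Z}"
    using eventually_happens'[OF time.ae_filter_bot] by blast
  from ae have "AE q in ?A. around (move g (fst q)) (snd q) \<in> coloured"
  proof eventually_elim
    case (elim q)
    let ?w = "g *v two_step (fst q) (snd q)"
    have n: "norm ?w = r" using g by (simp add: norm_orthogonal_matrix norm_two_step)
    then have "?w \<noteq> 0" using r_pos by auto
    have "norm (t *\<^sub>R ?w) < r" using n t r_pos by simp
    moreover have "radial_projection r (t *\<^sub>R ?w) = ?w"
      using n t r_pos by (simp add: radial_projection_def)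
    ultimately show ?case
      using elim t \<open>?w \<noteq> 0\<close> by (auto simp: around_move matrix_vector_mult_scaleR)
  qed
  then have "AE \<phi> in angle_measure. AE \<psi> in angle_measure. around (move g \<phi>) \<psi> \<in> coloured"
    using angles.AE_pair[of "\<lambda>q. around (move g (fst q)) (snd q) \<in> coloured"] by simp
  then show ?thesis by (simp add: circle_coloured_def)
qed

lemma sum_hit_eq_1:
  assumes "circle_coloured g"
  shows "(\<Sum>i\<in>colours. hit (E i) g) = 1"
proof -
  have "(\<Sum>i\<in>colours. hit (E i) g) = measure angle_measure (\<Union>i\<in>colours. {\<phi>. around g \<phi> \<in> E i})"
    unfolding hit_around
  proof (rule angle.finite_measure_finite_Union[symmetric])
    show "disjoint_family_on (\<lambda>i. {\<phi>. around g \<phi> \<in> E i}) colours"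
      using E_disjoint by (auto simp: disjoint_family_on_def)
  qed auto
  also have "(\<Union>i\<in>colours. {\<phi>. around g \<phi> \<in> E i}) = {\<phi>. around g \<phi> \<in> coloured}"
    by (auto simp: coloured_def)
  also have "measure angle_measure {\<phi>. around g \<phi> \<in> coloured} = 1"
    using assms angle.prob_Collect_eq_1[of "\<lambda>\<phi>. around g \<phi> \<in> coloured"] by (simp add: circle_coloured_def)
  finally show ?thesis .
qed

text \<open>
  There are points near which two colours are almost absent at distance 1. Otherwise the colour of a
  point is the only colour with proportion below \<open>\<eta>\<close> on its circle, so membership in \<open>E i\<close> can be
  read off from \<open>hit (E i)\<close> by a continuous function \<open>cut\<close>. Averaging over a circle turns the
  \<open>L\<^sup>1\<close>-continuity of \<open>hit\<close> into continuity of \<open>F i\<close>, which agrees with \<open>hit (E i)\<close> almost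
  everywhere on every circle. But the values of \<open>hit (E i)\<close> there avoid the gap between \<open>0\<close> and \<open>\<eta>\<close>.
  By connectedness, a colour with positive proportion on a circle fills almost all of it, although the
  circle contains points at distance 1.
\<close>

lemma ex_two_rare_colours:
  assumes \<eta>: "\<eta> > 0"
  obtains g i j where "orthogonal_matrix g" "circle_coloured g" "i \<in> colours" "j \<in> colours" "i \<noteq> j"
    "hit (E i) g < \<eta>" "hit (E j) g < \<eta>"
proof -
  have "\<exists>g i j. orthogonal_matrix g \<and> circle_coloured g \<and> i \<in> colours \<and> j \<in> colours \<and> i \<noteq> j \<and>
      hit (E i) g < \<eta> \<and> hit (E j) g < \<eta>"
  proof (rule ccontr)
    assume neg: "\<not> ?thesis"
    define cut where "cut s = max 0 (1 - s / \<eta>)" for s :: real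
    have cut_m [measurable]: "cut \<in> borel_measurable borel" unfolding cut_def[abs_def] by measurable
    have cut_0: "cut 0 = 1" and cut_1: "s \<ge> \<eta> \<Longrightarrow> cut s = 0" for s using \<eta> by (auto simp: cut_def)
    have cut_lip: "\<bar>cut s - cut t\<bar> \<le> (1 / \<eta>) * \<bar>s - t\<bar>" for s t
    proof -
      have "\<bar>cut s - cut t\<bar> \<le> \<bar>s / \<eta> - t / \<eta>\<bar>" unfolding cut_def by linarith
      also have "\<dots> = (1 / \<eta>) * \<bar>s - t\<bar>" using \<eta> by (simp add: diff_divide_distrib[symmetric])
      finally show ?thesis .
    qed
    have cut_bd: "\<bar>cut s\<bar> \<le> 1 + (1 / \<eta>) * \<bar>s\<bar>" for s using cut_lip[of s 0] cut_0 by simp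
    define F where "F i g = (\<integral>\<phi>. cut (hit (E i) (move g \<phi>)) \<partial>angle_measure)" for i g
    have F_cont: "continuous_on {g. orthogonal_matrix g} (F i)" for i
      unfolding F_def[abs_def]
      by (rule integral_lipschitz_hit_continuous[OF E_borel E_sphere cut_m _ cut_lip cut_bd]) (use \<eta> in simp)
    have cls: "AE \<phi> in angle_measure. circle_coloured (move g \<phi>) \<and> around g \<phi> \<in> coloured \<and>
        (\<forall>i\<in>colours. (around g \<phi> \<in> E i \<longrightarrow> hit (E i) (move g \<phi>) = 0) \<and>
                     (around g \<phi> \<notin> E i \<longrightarrow> hit (E i) (move g \<phi>) \<ge> \<eta>))"
      if g: "orthogonal_matrix g" "circle_coloured g" for g
      using AE_circle_coloured_move[OF g(1)] g(2)[unfolded circle_coloured_def]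
    proof eventually_elim
      case (elim \<phi>)
      from elim(2) obtain k where k: "k \<in> colours" "around g \<phi> \<in> E k" by (auto simp: coloured_def)
      have h0: "hit (E k) (move g \<phi>) < \<eta>" using hit_own_colour[OF g(1) k(2)] \<eta> by simp
      have "hit (E i) (move g \<phi>) \<ge> \<eta>" if "i \<in> colours" "around g \<phi> \<notin> E i" for i
      proof (rule ccontr)
        assume "\<not> ?thesis"
        then have "hit (E i) (move g \<phi>) < \<eta>" by simp
        moreover have "i \<noteq> k" using that k by auto
        ultimately show False using neg h0 that(1) k(1) elim(1) orthogonal_move[OF g(1)] by blast
      qed
      then show ?case using elim hit_own_colour[OF g(1)] by blast
    qed
    have F_eq: "F i g = hit (E i) g" if g: "orthogonal_matrix g" "circle_coloured g" and i: "i \<in> colours" for i g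
    proof -
      have "F i g = (\<integral>\<phi>. indicator {\<phi>. around g \<phi> \<in> E i} \<phi> \<partial>angle_measure)"
        unfolding F_def
      proof (rule integral_cong_AE)
        show "AE \<phi> in angle_measure. cut (hit (E i) (move g \<phi>)) = indicat_real {\<phi>. around g \<phi> \<in> E i} \<phi>"
          using cls[OF g] by eventually_elim (use i cut_0 cut_1 in \<open>auto simp: indicator_def\<close>)
        show "(\<lambda>\<phi>. cut (hit (E i) (move g \<phi>))) \<in> borel_measurable angle_measure" by measurable
        show "indicat_real {\<phi>. around g \<phi> \<in> E i} \<in> borel_measurable angle_measure" by measurable
      qed
      then show ?thesis by (simp add: hit_around)
    qed
    obtain g where g: "orthogonal_matrix g" "circle_coloured g"
      using eventually_happens'[OF angle.ae_filter_bot AE_circle_coloured_move[OF orthogonal_matrix_id]]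
        orthogonal_move[OF orthogonal_matrix_id] by blast
    obtain j where j: "j \<in> colours" "hit (E j) g > 0"
    proof -
      have "\<exists>j\<in>colours. hit (E j) g \<noteq> 0"
      proof (rule ccontr)
        assume "\<not> ?thesis"
        then have "(\<Sum>i\<in>colours. hit (E i) g) = 0" by (intro sum.neutral) auto
        then show False using sum_hit_eq_1[OF g(2)] by simp
      qed
      then show ?thesis using that hit_nonneg by (metis order_le_less)
    qed
    define f where "f \<phi> = F j (move g \<phi>)" for \<phi>
    have f_cont: "continuous_on UNIV f"
      unfolding f_def
      by (rule continuous_on_compose2[OF F_cont continuous_on_move]) (use orthogonal_move[OF g(1)] in auto)
    have f_per: "f (\<phi> + 2 * pi) = f \<phi>" for \<phi> by (simp add: f_def move_periodic)
    have f_ae: "AE \<phi> in angle_measure. f \<phi> = hit (E j) (move g \<phi>) \<and> (around g \<phi> \<in> E j \<longrightarrow> f \<phi> = 0)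
        \<and> (around g \<phi> \<notin> E j \<longrightarrow> f \<phi> \<ge> \<eta>)"
      using cls[OF g]
    proof eventually_elim
      case (elim \<phi>)
      then show ?case using F_eq[OF orthogonal_move[OF g(1)], of \<phi> j] j(1) by (auto simp: f_def)
    qed
    have f_vals: "f \<phi> \<in> {0} \<union> {\<eta>..}" for \<phi>
    proof (rule AE_angle_closed_imp_all[OF f_cont f_per])
      show "AE \<phi> in angle_measure. f \<phi> \<in> {0} \<union> {\<eta>..}"
        using f_ae by eventually_elim auto
    qed auto
    have "\<not> (AE \<phi> in angle_measure. around g \<phi> \<notin> E j)"
    proof
      assume "AE \<phi> in angle_measure. around g \<phi> \<notin> E j"
      then have "measure angle_measure {\<phi>. around g \<phi> \<in> E j} = 0"
        using angle.prob_Collect_eq_0[of "\<lambda>\<phi>. around g \<phi> \<in> E j"] by simp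
      then show False using j(2) by (simp add: hit_around)
    qed
    have "\<exists>\<phi>1. f \<phi>1 = 0"
    proof (rule ccontr)
      assume "\<not> ?thesis"
      then have "AE \<phi> in angle_measure. around g \<phi> \<notin> E j"
        using f_ae by (auto elim: eventually_mono)
      then show False using \<open>\<not> (AE \<phi> in angle_measure. around g \<phi> \<notin> E j)\<close> by simp
    qed
    then obtain \<phi>1 where \<phi>1: "f \<phi>1 = 0" ..
    have f0: "f \<phi> = 0" for \<phi>
    proof (rule ccontr)
      assume "f \<phi> \<noteq> 0"
      then have "f \<phi> \<ge> \<eta>" using f_vals[of \<phi>] by auto
      moreover have "connected (range f)" using connected_continuous_image[OF f_cont] by auto
      ultimately have "\<eta> / 2 \<in> range f"
        using connectedD_interval[of "range f" "f \<phi>1" "f \<phi>" "\<eta> / 2"] \<phi>1 \<eta> by auto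
      then obtain x where "f x = \<eta> / 2" by (metis imageE)
      then show False using f_vals[of x] \<eta> by simp
    qed
    have "AE \<phi> in angle_measure. around g \<phi> \<in> E j"
      using f_ae by eventually_elim (use f0 \<eta> in force)
    moreover from this have "AE \<phi> in angle_measure. around g (\<phi> + \<theta>) \<in> E j"
      by (intro AE_angle_shift) (simp_all add: around_periodic)
    ultimately have "AE \<phi> in angle_measure. False"
      by eventually_elim (use E_avoids_1 dist_around_theta[OF g(1)] in blast)
    then show False by simp
  qed
  then show ?thesis using that by blast
qed


lemma alternating_colours:
  assumes g: "orthogonal_matrix g" and two: "\<And>t. t \<le> m \<Longrightarrow> around g (\<phi> + real t * \<theta>) \<in> E k \<union> E l"
    and start: "around g \<phi> \<in> E k"
  shows "t \<le> m \<Longrightarrow> around g (\<phi> + real t * \<theta>) \<in> (if even t then E k else E l)"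
proof (induction t)
  case 0
  then show ?case using start by simp
next
  case (Suc t)
  have "dist (around g (\<phi> + real t * \<theta>)) (around g (\<phi> + real (Suc t) * \<theta>)) = 1"
    using dist_around_theta[OF g, of "\<phi> + real t * \<theta>"] by (simp add: algebra_simps)
  moreover have "around g (\<phi> + real t * \<theta>) \<in> (if even t then E k else E l)" using Suc by simp
  ultimately have "around g (\<phi> + real (Suc t) * \<theta>) \<notin> (if even t then E k else E l)"
    using E_avoids_1 by (auto split: if_splits)
  then show ?case using two[OF Suc.prems] by (auto split: if_splits)
qed

text \<open>
  If colours \<open>i\<close> and \<open>j\<close> are almost absent from a circle, then along the orbits of the rotation by
  \<open>\<theta>\<close> the colours \<open>k\<close> and \<open>l\<close> mostly alternate. After an odd number \<open>m\<close> of steps the colour has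
  changed, so the point \<open>x\<close> and its \<open>m\<close>-th image \<open>y\<close> have colours \<open>k\<close> and \<open>l\<close> in some order, and the
  colour of each is absent from the unit circle about it. If \<open>m\<close> steps make nearly a full turn, then
  \<open>L\<^sup>1\<close>-continuity identifies the two points, and both \<open>k\<close> and \<open>l\<close> are nearly absent from the unit
  circles about most points of the original circle.
\<close>

lemma other_colours_missed:
  assumes e: "e > 0"
  obtains \<eta> where "\<eta> > 0"
    "\<And>g i j k l. \<lbrakk>orthogonal_matrix g; circle_coloured g; {i, j, k, l} = colours; hit (E i) g < \<eta>; hit (E j) g < \<eta>\<rbrakk>
      \<Longrightarrow> hit2 (E k) g + hit2 (E l) g < e"
proof -
  have "\<exists>d>0. \<forall>g g'. orthogonal_matrix g \<longrightarrow> orthogonal_matrix g' \<longrightarrow> norm (g - g') < d \<longrightarrow>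
      (\<integral>\<phi>. \<bar>hit (E k) (move g \<phi>) - hit (E k) (move g' \<phi>)\<bar> \<partial>angle_measure) < e / 4" for k
  proof -
    have e4: "e / 4 > 0" using e by simp
    show ?thesis by (rule hit_move_L1_uniformly_continuous[OF E_borel E_sphere e4, of k]) blast
  qed
  then obtain d where d: "\<And>k. d k > 0" "\<And>k g g'. \<lbrakk>orthogonal_matrix g; orthogonal_matrix g'; norm (g - g') < d k\<rbrakk> \<Longrightarrow>
      (\<integral>\<phi>. \<bar>hit (E k) (move g \<phi>) - hit (E k) (move g' \<phi>)\<bar> \<partial>angle_measure) < e / 4"
    by metis
  define D where "D = Min (d ` colours)"
  have D: "D > 0" "k \<in> colours \<Longrightarrow> D \<le> d k" for k
    using d(1) by (auto simp: D_def)
  obtain \<delta> where \<delta>: "\<delta> > 0" "\<And>(g::real^3^3) a. \<lbrakk>orthogonal_matrix g; \<bar>a\<bar> < \<delta>\<rbrakk> \<Longrightarrow> norm (g ** rot a - g) < D"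
    using orthogonal_right_rot_close[OF D(1)] by blast
  obtain m :: nat and n :: int where m: "odd m" "\<bar>real m * \<theta> - 2 * pi * of_int n\<bar> < \<delta>"
    using odd_near_turn[OF \<delta>(1)] by blast
  have rotm: "rot (real m * \<theta>) = rot (real m * \<theta> - 2 * pi * of_int n)"
    using rot_periodic_int[of "real m * \<theta> - 2 * pi * of_int n" n] by simp
  \<comment> \<open>Each of the \<open>m + 1\<close> points of an orbit segment is badly coloured with probability at most
    \<open>2 * \<eta>\<close>, and a bad segment costs at most 2; this adds up to \<open>e / 4\<close>. The two shifts cost
    \<open>e / 4\<close> each.\<close>
  define \<eta> where "\<eta> = e / (16 * real (m + 1))"
  show ?thesis
  proof (rule that[of \<eta>])
    show "\<eta> > 0" using e by (simp add: \<eta>_def)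
    fix g i j k l
    assume g: "orthogonal_matrix g" "circle_coloured g" and col: "{i, j, k, l} = colours"
      and hi: "hit (E i) g < \<eta>" and hj: "hit (E j) g < \<eta>"
    have kl: "k \<in> colours" "l \<in> colours" using col by auto
    have shift: "(\<integral>\<phi>. \<bar>hit (E x) (move g (\<phi> + real m * \<theta>)) - hit (E x) (move g \<phi>)\<bar> \<partial>angle_measure) < e / 4"
      if "x \<in> colours" for x
    proof -
      have "norm (g ** rot (real m * \<theta>) - g) < D"
        unfolding rotm by (rule \<delta>(2)[OF g(1) m(2)])
      then have "norm (g ** rot (real m * \<theta>) - g) < d x" using D(2)[OF that] by (rule less_le_trans)
      from d(2)[OF orthogonal_matrix_mul[OF g(1) orthogonal_rot] g(1) this] show ?thesis
        unfolding move_rot .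
    qed
    define bad where "bad = {\<phi>. around g \<phi> \<notin> E k \<union> E l}"
    have badm [measurable]: "bad \<in> sets borel" unfolding bad_def by measurable
    have "measure angle_measure bad \<le> measure angle_measure ({\<phi>. around g \<phi> \<in> E i} \<union> {\<phi>. around g \<phi> \<in> E j})"
    proof (rule angle.finite_measure_mono_AE)
      have "coloured = E i \<union> E j \<union> E k \<union> E l" unfolding coloured_def col[symmetric] by auto
      then show "AE \<phi> in angle_measure. \<phi> \<in> bad \<longrightarrow> \<phi> \<in> {\<phi>. around g \<phi> \<in> E i} \<union> {\<phi>. around g \<phi> \<in> E j}"
        using g(2) unfolding circle_coloured_def by (auto simp: bad_def elim!: eventually_mono)
    qed measurable
    also have "\<dots> \<le> hit (E i) g + hit (E j) g"
      unfolding hit_around by (rule measure_Un_le) measurable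
    finally have bad: "measure angle_measure bad \<le> 2 * \<eta>" using hi hj by simp
    define Bad where "Bad = (\<Union>t\<in>{..m}. {\<phi>. \<phi> + real t * \<theta> \<in> bad})"
    have Badm [measurable]: "Bad \<in> sets borel" unfolding Bad_def by measurable
    have "measure angle_measure Bad \<le> (\<Sum>t\<le>m. measure angle_measure {\<phi>. \<phi> + real t * \<theta> \<in> bad})"
      unfolding Bad_def by (rule measure_UNION_le) (simp, measurable)
    also have "\<dots> = (\<Sum>t\<le>m. measure angle_measure {\<phi>. \<phi> \<in> bad})"
      by (intro sum.cong refl measure_angle_shift) (auto simp: bad_def around_periodic)
    also have "\<dots> \<le> (\<Sum>t\<le>m. 2 * \<eta>)" using bad by (intro sum_mono) simp
    also have "\<dots> = e / 8" by (simp add: \<eta>_def field_simps)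
    finally have Bad: "measure angle_measure Bad \<le> e / 8" .
    define V where "V x \<phi> = hit (E x) (move g \<phi>)" for x \<phi>
    have Vi: "integrable angle_measure (V x)" "integrable angle_measure (\<lambda>\<phi>. V x (\<phi> + real m * \<theta>))" for x
      using integrable_hit_move[OF E_borel, of x g] integrable_hit_move[OF E_borel, of x "g ** rot (real m * \<theta>)"]
      by (simp_all add: V_def[abs_def] move_rot)
    have V01: "0 \<le> V x \<phi>" "V x \<phi> \<le> 1" for x \<phi> by (simp_all add: V_def hit_nonneg hit_le_1)
    have pointwise: "V k \<phi> + V l \<phi> \<le> 2 * indicator Bad \<phi> +
        (\<bar>V k (\<phi> + real m * \<theta>) - V k \<phi>\<bar> + \<bar>V l (\<phi> + real m * \<theta>) - V l \<phi>\<bar>)" for \<phi>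
    proof (cases "\<phi> \<in> Bad")
      case True
      then show ?thesis using V01[of k \<phi>] V01[of l \<phi>] by simp
    next
      case False
      then have two: "around g (\<phi> + real t * \<theta>) \<in> E k \<union> E l" if "t \<le> m" for t
        using that by (auto simp: Bad_def bad_def)
      have *: "V a \<phi> = 0 \<and> V b (\<phi> + real m * \<theta>) = 0"
        if ab: "{a, b} = {k, l}" and "around g \<phi> \<in> E a" for a b
      proof -
        have "E a \<union> E b = E k \<union> E l" using ab by (metis Un_commute doubleton_eq_iff)
        then have "around g (\<phi> + real m * \<theta>) \<in> E b"
          using alternating_colours[OF g(1), of m \<phi> a b m] two that(2) m(1) by auto
        then show ?thesis using that(2) hit_own_colour[OF g(1)] by (simp add: V_def)
      qed
      have "around g \<phi> \<in> E k \<union> E l" using two[of 0] by simp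
      then show ?thesis using *[of k l] *[of l k] False by (auto simp: insert_commute)
    qed
    have "hit2 (E k) g + hit2 (E l) g = (\<integral>\<phi>. V k \<phi> + V l \<phi> \<partial>angle_measure)"
      using Vi by (simp add: hit2_def V_def)
    also have "\<dots> \<le> (\<integral>\<phi>. 2 * indicator Bad \<phi> +
        (\<bar>V k (\<phi> + real m * \<theta>) - V k \<phi>\<bar> + \<bar>V l (\<phi> + real m * \<theta>) - V l \<phi>\<bar>) \<partial>angle_measure)"
      using Vi pointwise
      by (intro integral_mono Bochner_Integration.integrable_add integrable_mult_right integrable_abs
          Bochner_Integration.integrable_diff angle.integrable_const_bound[of "indicator Bad" 1]) auto
    also have "\<dots> = 2 * measure angle_measure Bad + ((\<integral>\<phi>. \<bar>V k (\<phi> + real m * \<theta>) - V k \<phi>\<bar> \<partial>angle_measure)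
        + (\<integral>\<phi>. \<bar>V l (\<phi> + real m * \<theta>) - V l \<phi>\<bar> \<partial>angle_measure))"
    proof -
      have I: "integrable angle_measure (\<lambda>\<phi>. 2 * indicat_real Bad \<phi>)"
        by (intro integrable_mult_right angle.integrable_const_bound[of "indicator Bad" 1]) auto
      have J: "integrable angle_measure (\<lambda>\<phi>. \<bar>V x (\<phi> + real m * \<theta>) - V x \<phi>\<bar>)" for x
        using Vi by (intro integrable_abs Bochner_Integration.integrable_diff)
      show ?thesis using I J by simp
    qed
    also have "\<dots> < e" using Bad shift[OF kl(1)] shift[OF kl(2)] e unfolding V_def by linarith
    finally show "hit2 (E k) g + hit2 (E l) g < e" .
  qed
qed

text \<open>
  The limit \<open>\<eta> \<rightarrow> 0\<close>: unlike \<open>hit\<close>, the function \<open>hit2\<close> is continuous, so its infimum is attained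
  on the compact orthogonal group.
\<close>

lemma ex_frame_two_step_missing:
  obtains g i j k l where "orthogonal_matrix g" "{i, j, k, l} = colours" "hit2 (E k) g + hit2 (E l) g = 0"
proof -
  let ?O = "{g :: real^3^3. orthogonal_matrix g}"
  let ?Q = "\<lambda>k l g. hit2 (E k) g + hit2 (E l) g"
  have "\<exists>g i j k l. orthogonal_matrix g \<and> {i, j, k, l} = colours \<and> ?Q k l g = 0"
  proof (rule ccontr)
    assume neg: "\<not> ?thesis"
    have "\<exists>e>0. \<forall>g\<in>?O. e \<le> ?Q k l g" if "\<exists>i j. {i, j, k, l} = colours" for k l
    proof -
      have "continuous_on ?O (?Q k l)"
        by (intro continuous_on_add hit2_continuous E_borel E_sphere)
      moreover have "?O \<noteq> {}" using orthogonal_matrix_id by blast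
      ultimately obtain g where g: "g \<in> ?O" "\<forall>h\<in>?O. ?Q k l g \<le> ?Q k l h"
        using continuous_attains_inf[OF compact_orthogonal_matrices] by blast
      have "?Q k l g \<noteq> 0" using neg that g(1) by blast
      then have "?Q k l g > 0" using hit2_nonneg[of "E k" g] hit2_nonneg[of "E l" g] by linarith
      then show ?thesis using g(2) by blast
    qed
    then have "\<exists>e>0. (\<exists>i j. {i, j, k, l} = colours) \<longrightarrow> (\<forall>g\<in>?O. e \<le> ?Q k l g)" for k l
      using zero_less_one by (cases "\<exists>i j. {i, j, k, l} = colours") blast+
    then have "\<exists>e. \<forall>k l. e k l > 0 \<and> ((\<exists>i j. {i, j, k, l} = colours) \<longrightarrow> (\<forall>g\<in>?O. e k l \<le> ?Q k l g))"
      by (intro choice allI) blast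
    then obtain e where e: "\<And>k l. e k l > 0"
      "\<And>k l g. \<lbrakk>\<exists>i j. {i, j, k, l} = colours; g \<in> ?O\<rbrakk> \<Longrightarrow> e k l \<le> ?Q k l g" by blast
    define e0 where "e0 = Min ((\<lambda>(k, l). e k l) ` (colours \<times> colours))"
    have e0: "e0 > 0" "\<lbrakk>k \<in> colours; l \<in> colours\<rbrakk> \<Longrightarrow> e0 \<le> e k l" for k l
      using e(1) by (auto simp: e0_def intro!: Min_le)
    obtain \<eta> where \<eta>: "\<eta> > 0"
      "\<And>g i j k l. \<lbrakk>orthogonal_matrix g; circle_coloured g; {i, j, k, l} = colours; hit (E i) g < \<eta>; hit (E j) g < \<eta>\<rbrakk>
      \<Longrightarrow> ?Q k l g < e0"
      by (rule other_colours_missed[OF e0(1)]) blast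
    obtain g i j where g: "orthogonal_matrix g" "circle_coloured g" "i \<in> colours" "j \<in> colours" "i \<noteq> j"
      "hit (E i) g < \<eta>" "hit (E j) g < \<eta>"
      by (rule ex_two_rare_colours[OF \<eta>(1)])
    have "card (colours - {i, j}) = 2" using g by (simp add: card_Diff_subset)
    then obtain k l where "colours - {i, j} = {k, l}" by (auto simp: card_2_iff)
    then have kl: "{i, j, k, l} = colours" using g(3,4) by blast
    then have "k \<in> colours" "l \<in> colours" by blast+
    then have "e0 \<le> e k l" by (rule e0(2))
    also have "e k l \<le> ?Q k l g" by (rule e(2)) (use kl g(1) in blast)+
    finally have "e0 \<le> ?Q k l g" .
    then show False using \<eta>(2)[OF g(1,2) kl g(6,7)] by simp
  qed
  then show ?thesis using that by blast
qed

text \<open>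
  If two-step walks from \<open>g\<close> almost never end in colours \<open>k\<close> and \<open>l\<close>, then these two colours are
  absent from the circles about almost all neighbours of \<open>g\<close>, and the alternation argument applies
  to these neighbours with the two pairs of colours exchanged.
\<close>

lemma missing_pair_swaps:
  assumes g: "orthogonal_matrix g" and col: "{i, j, k, l} = colours"
    and Q: "hit2 (E k) g + hit2 (E l) g = 0"
  shows "hit2 (E i) (move g \<phi>) + hit2 (E j) (move g \<phi>) = 0"
proof -
  let ?F = "\<lambda>\<phi>. hit2 (E i) (move g \<phi>) + hit2 (E j) (move g \<phi>)"
  have zero: "AE \<phi> in angle_measure. hit (E x) (move g \<phi>) = 0" if "x \<in> {k, l}" for x
  proof -
    have "hit2 (E x) g = 0" using that Q hit2_nonneg[of "E k" g] hit2_nonneg[of "E l" g] by auto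
    then show ?thesis
      unfolding hit2_def
      by (subst (asm) integral_nonneg_eq_0_iff_AE) (auto simp: hit_nonneg)
  qed
  have "AE \<phi> in angle_measure. ?F \<phi> = 0"
    using zero[of k, simplified] zero[of l, simplified] AE_circle_coloured_move[OF g]
  proof eventually_elim
    case (elim \<phi>)
    have "?F \<phi> < e" if e: "e > 0" for e
    proof -
      obtain \<eta> where \<eta>: "\<eta> > 0"
        "\<And>g i j k l. \<lbrakk>orthogonal_matrix g; circle_coloured g; {i, j, k, l} = colours; hit (E i) g < \<eta>; hit (E j) g < \<eta>\<rbrakk>
          \<Longrightarrow> hit2 (E k) g + hit2 (E l) g < e"
        by (rule other_colours_missed[OF e]) blast
      have "{k, l, i, j} = colours" using col by blast
      from \<eta>(2)[OF orthogonal_move[OF g] elim(3) this] show ?thesis using elim(1,2) \<eta>(1) by simp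
    qed
    then have "?F \<phi> \<le> 0" using less_irrefl not_le by blast
    then show ?case using hit2_nonneg[of "E i" "move g \<phi>"] hit2_nonneg[of "E j" "move g \<phi>"] by linarith
  qed
  moreover have "continuous_on UNIV ?F"
    using orthogonal_move[OF g]
    by (intro continuous_on_add continuous_on_compose2[OF hit2_continuous[OF E_borel E_sphere] continuous_on_move]) auto
  ultimately have "?F \<phi> \<in> {0}"
    by (intro AE_angle_closed_imp_all) (auto simp: move_periodic)
  then show ?thesis by simp
qed

lemma no_four_colouring: False
proof -
  obtain g i j k l where g: "orthogonal_matrix g" and col: "{i, j, k, l} = colours"
    and Q: "hit2 (E k) g + hit2 (E l) g = 0"
    by (rule ex_frame_two_step_missing)
  \<comment> \<open>From the frame at \<open>g\<close>, the third vertex of an equilateral triangle is reached in one step and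
    also, up to a rotation about this vertex, in two steps.\<close>
  let ?h = "move g \<theta>"
  have col': "{k, l, i, j} = colours" using col by blast
  have ij: "hit2 (E i) (move g \<phi>) + hit2 (E j) (move g \<phi>) = 0" for \<phi>
    by (rule missing_pair_swaps[OF g col Q])
  have "hit2 (E k) (move (move g 0) (pi - \<theta>)) + hit2 (E l) (move (move g 0) (pi - \<theta>)) = 0"
    by (rule missing_pair_swaps[OF orthogonal_move[OF g] col' ij])
  moreover have "move (move g 0) (pi - \<theta>) = ?h ** rot \<theta>"
  proof -
    have "rot 0 = mat 1" by (simp add: matrix_3_simps rot_def)
    then have "move (move g 0) (pi - \<theta>) = g ** (tilt ** rot (pi - \<theta>) ** tilt)"
      by (simp add: move_def matrix_mul_assoc)
    then show ?thesis by (simp add: triangle_closes move_def matrix_mul_assoc)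
  qed
  ultimately have kl: "hit2 (E k) ?h + hit2 (E l) ?h = 0" by (simp add: hit2_rot[OF E_borel])
  have "hit2 (E x) ?h = 0" if "x \<in> colours" for x
  proof -
    have "x \<in> {i, j, k, l}" using that col by simp
    then show ?thesis using kl ij[of \<theta>] hit2_nonneg[of "E i" ?h] hit2_nonneg[of "E j" ?h]
        hit2_nonneg[of "E k" ?h] hit2_nonneg[of "E l" ?h] by auto
  qed
  then have "(\<Sum>x\<in>colours. hit2 (E x) ?h) = 0" by simp
  moreover have "(\<Sum>x\<in>colours. hit2 (E x) ?h) = (\<integral>\<phi>. (\<Sum>x\<in>colours. hit (E x) (move ?h \<phi>)) \<partial>angle_measure)"
    unfolding hit2_def by (rule Bochner_Integration.integral_sum[symmetric]) simp
  moreover have "(\<integral>\<phi>. (\<Sum>x\<in>colours. hit (E x) (move ?h \<phi>)) \<partial>angle_measure) = (\<integral>\<phi>. 1 \<partial>angle_measure)"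
  proof (rule integral_cong_AE)
    show "AE \<phi> in angle_measure. (\<Sum>x\<in>colours. hit (E x) (move ?h \<phi>)) = 1"
      using AE_circle_coloured_move[OF orthogonal_move[OF g]] by eventually_elim (rule sum_hit_eq_1)
    show "(\<lambda>\<phi>. \<Sum>x\<in>colours. hit (E x) (move ?h \<phi>)) \<in> borel_measurable angle_measure" by measurable
  qed simp
  ultimately show False using angle.prob_space by simp
qed

end

theorem theorem1p1:
  fixes r \<theta> c :: real
  assumes "r > 1 / sqrt 3"
    and "\<theta> = 2 * arcsin (r / sqrt (4 * r\<^sup>2 - 1))"
    and "\<theta> = c * pi"
    and "c \<notin> \<rat> \<or> (\<exists>p q :: nat. q > 0 \<and> c = real p / real q \<and> gcd p q = 1 \<and> even p)"
  shows "measurable_chromatic_number r \<ge> 5"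
proof (rule ccontr)
  assume "\<not> measurable_chromatic_number r \<ge> 5"
  moreover obtain k \<phi> where k: "measurable_chromatic_number r = enat k" and col: "measurable_colouring r k \<phi>"
    using measurable_chromatic_number_attained by blast
  moreover have "(5 :: enat) = enat 5" by (simp add: numeral_eq_enat)
  ultimately have k4: "k \<le> 4" by simp
  interpret unit_distance_sphere r \<theta> using assms(1,2) by unfold_locales
  let ?M = "distr (scale_measure (ennreal (3 / r)) (restrict_space lborel (ball 0 r - {0})))
            (restrict_space borel (sphere 0 r)) (radial_projection r) :: (real^3) measure"
  have sM: "sets ?M = sets (restrict_space borel (sphere 0 r :: (real^3) set))" by simp
  have borelM: "X \<in> sets borel \<and> X \<subseteq> sphere 0 r" if "X \<in> sets ?M" for X :: "(real^3) set"
    using that unfolding sM by (auto simp: sets_restrict_space)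
  \<comment> \<open>The colour classes are measurable only for the completed measure; a Borel kernel of each class
    omits no more than a null set.\<close>
  define C where "C i = {x \<in> sphere 0 r. \<phi> x = i}" for i
  have "\<exists>S N. S \<in> sets ?M \<and> N \<in> null_sets ?M \<and> S \<subseteq> C i \<and> C i - S \<subseteq> N" for i
  proof (cases "i \<in> {1..k}")
    case True
    then have "C i \<in> sets (completion ?M)"
      using col by (simp add: measurable_colouring_def C_def sphere_measure_def)
    then obtain S N N' where "C i = S \<union> N" "N \<subseteq> N'" "N' \<in> null_sets ?M" "S \<in> sets ?M"
      by (rule sets_completionE)
    then show ?thesis by blast
  next
    case False
    then have "C i = {}" using col by (auto simp: measurable_colouring_def C_def Pi_iff)
    then show ?thesis by (intro exI[of _ "{}"]) auto
  qed
  then obtain E N where E: "\<And>i. E i \<in> sets ?M" "\<And>i. N i \<in> null_sets ?M" "\<And>i. E i \<subseteq> C i" "\<And>i. C i - E i \<subseteq> N i"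
    by metis
  have Z: "{x \<in> ball 0 r - {0}. radial_projection r x \<in> N i} \<in> null_sets lborel" for i
  proof -
    have Nb: "N i \<in> sets borel" "N i \<subseteq> sphere 0 r" using borelM[OF null_setsD2[OF E(2)[of i]]] by blast+
    have "emeasure (sphere_measure r) (N i) = emeasure ?M (N i)"
      unfolding sphere_measure_def using E(2)[of i] by (subst emeasure_completion) auto
    then have "emeasure (sphere_measure r) (N i) = 0" using E(2)[of i] by auto
    then have 0: "emeasure lborel {x \<in> ball 0 r - {0}. radial_projection r x \<in> N i} = 0"
      using emeasure_sphere_measure[OF r_pos Nb] r_pos by auto
    have "{x \<in> ball 0 r - {0}. radial_projection r x \<in> N i} \<in> sets lborel"
      using radial_cone_borel[OF Nb(1), of r] by simp
    then show ?thesis using 0 by blast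
  qed
  have rp: "radial_projection r x \<in> sphere 0 r" if "x \<noteq> 0" for x :: "real^3"
    using that r_pos by (simp add: radial_projection_def)
  interpret four_colouring r \<theta> E
  proof unfold_locales
    show "E i \<in> sets borel" "E i \<subseteq> sphere 0 r" for i using borelM[OF E(1)] by auto
    show "E i \<inter> E j = {}" if "i \<noteq> j" for i j using E(3)[of i] E(3)[of j] that by (auto simp: C_def)
    show "dist x y \<noteq> 1" if "x \<in> E i" "y \<in> E i" for x y i
    proof -
      have "x \<in> C i" "y \<in> C i" using that E(3)[of i] by blast+
      then have xy: "x \<in> sphere 0 r" "y \<in> sphere 0 r" "\<phi> x = \<phi> y" unfolding C_def by simp_all
      have "\<forall>u\<in>sphere 0 r. \<forall>v\<in>sphere 0 r. dist u v = 1 \<longrightarrow> \<phi> u \<noteq> \<phi> v"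
        using col unfolding measurable_colouring_def by blast
      from this[rule_format, OF xy(1,2)] xy(3) show ?thesis by blast
    qed
    have null: "(\<Union>i\<in>colours. {x \<in> ball 0 r - {0}. radial_projection r x \<in> N i}) \<in> null_sets lborel"
      by (rule null_sets_UN') (use Z in auto)
    have sub: "{x \<in> ball 0 r - {0}. radial_projection r x \<notin> (\<Union>i\<in>colours. E i)}
        \<subseteq> (\<Union>i\<in>colours. {x \<in> ball 0 r - {0}. radial_projection r x \<in> N i})"
    proof
      fix x assume x: "x \<in> {x \<in> ball 0 r - {0}. radial_projection r x \<notin> (\<Union>i\<in>colours. E i)}"
      let ?y = "radial_projection r x"
      have y: "?y \<in> sphere 0 r" using rp x by auto
      then have "\<phi> ?y \<in> {1..k}" using col unfolding measurable_colouring_def by blast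
      then have "\<phi> ?y \<in> colours" using k4 by auto
      moreover have "?y \<in> C (\<phi> ?y)" using y by (simp add: C_def)
      ultimately show "x \<in> (\<Union>i\<in>colours. {x \<in> ball 0 r - {0}. radial_projection r x \<in> N i})"
        using x E(4)[of "\<phi> ?y"] by blast
    qed
    have meas: "{x \<in> ball 0 r - {0}. radial_projection r x \<notin> (\<Union>i\<in>colours. E i)} \<in> sets lborel"
    proof -
      have "- (\<Union>i\<in>colours. E i) \<in> sets borel" using borelM[OF E(1)] by (intro borel_comp) blast
      from radial_cone_borel[OF this, of r] show ?thesis by simp
    qed
    show "{x \<in> ball 0 r - {0}. radial_projection r x \<notin> (\<Union>i\<in>colours. E i)} \<in> null_sets lborel"
      by (rule null_sets_subset[OF null meas sub])
    show "\<exists>m l. odd (m::nat) \<and> \<bar>real m * \<theta> - 2 * pi * of_int l\<bar> < e" if "e > 0" for e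
      using odd_multiple_near_full_turn[OF assms(4) that] unfolding assms(3) by blast
  qed
  show False by (rule no_four_colouring)
qed

end
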